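(* Let $p\in A=\mathbb{C}[T]$ satisfy $p(\boldsymbol{1})=1$. The following conditions are equivalent. (i) The Laurent polynomial $f=1-\sum_{\sigma\in G}p^{\sigma*}p^{\sigma}$ is a sum of hermitian squares in $A$; that is, there exist $h_1,\dots,h_r\in A$ with $f=\sum_{j=1}^r h_j^*h_j$. (ii) For any hermitian elements $h_\chi=h_\chi^*\in A_{-\chi}\otimes A_\chi$ $(\chi\in G')$ with $\mu(h_\chi)=\frac1m$ for all $\chi\in G'$, the element $$g:=\sum_{\chi\in G'}h_\chi-p^*\otimes p$$ is a sum of hermitian squares in $A\otimes A$ modulo $J$; that is, there exist $q_1,\dots,q_N\in A$ with $g-\sum_{j=1}^N q_j^*\otimes q_j\in J$. (iii) There exist $q_1,\dots,q_N\in A$ such that $$\delta_{\sigma,\tau}-p^{\sigma*}p^{\tau}=\sum_{j=1}^N q_j^{\sigma*}q_j^{\tau}\qquad\text{for all }\sigma,\tau\in G.$$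
   Context: Let $d\in\mathbb{N}$ and $A=\mathbb{C}[T]=\mathbb{C}[z_1^{\pm1},\dots,z_d^{\pm1}]$ be the ring of complex Laurent polynomials, with the involution $*$ given by $z_j^*=z_j^{-1}$ and complex conjugation on coefficients. Laurent polynomials are identified with trigonometric polynomials via $z=\boldsymbol{e}^{-i\omega}=(e^{-i\omega_1},\dots,e^{-i\omega_d})$, $\omega\in\mathbb{R}^d$; $\boldsymbol{1}=(1,\dots,1)$. Let $M\in\mathbb{Z}^{d\times d}$ be expansive (all eigenvalues have modulus strictly larger than $1$), $m=|\det M|$, $G=2\pi M^{-T}\mathbb{Z}^d/2\pi\mathbb{Z}^d$ (a finite abelian group of order $m$), and $G'=\mathbb{Z}^d/M\mathbb{Z}^d$. For $p\in A$ and $\sigma\in G$, $p^\sigma\in A$ is defined by $p^\sigma(\boldsymbol{e}^{-i\omega})=p(\boldsymbol{e}^{-i(\omega+\sigma)})$, and $p^{\sigma*}=(p^\sigma)^*$. $\delta_{\sigma,\tau}$ is the Kronecker delta. Grading: for $\chi\in G'$, $A_\chi$ is the $\mathbb{C}$-span of the monomials $z^\alpha$ with $\alpha+M\mathbb{Z}^d=\chi$, so that $A=\bigoplus_{\chi\in G'}A_\chi$. Write $A\otimes A=A\otimes_{\mathbb{C}}A$, the ring of Laurent polynomials in $2d$ variables $u_j=z_j\otimes1$, $v_j=1\otimes z_j$. It is graded by $A\otimes A=\bigoplus_{\chi,\eta\in G'}A_\chi\otimes A_\eta$, where $A_\chi\otimes A_\eta$ is spanned by the monomials $u^\alpha v^\beta$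 with $\alpha+M\mathbb{Z}^d=\chi$, $\beta+M\mathbb{Z}^d=\eta$. The involution $*$ on $A\otimes A$ is the (conjugate-linear) one with $(p\otimes q)^*=q^*\otimes p^*$, so $u_j^*=v_j^{-1}$ and $v_j^*=u_j^{-1}$; $f\in A\otimes A$ is called hermitian if $f=f^*$. An element of $A\otimes A$ is called a sum of hermitian squares if it has the form $\sum_{k=1}^r q_k^*\otimes q_k$ with $q_k\in A$. Let $\mu:A\otimes A\to A$ be the multiplication homomorphism $\mu(p\otimes q)=pq$, let $I=\ker\mu$, and let $J=\bigoplus_{\chi,\eta\in G'}\bigl(I\cap(A_\chi\otimes A_\eta)\bigr)$, an ideal of $A\otimes A$. *)

theory Defs
  imports "HOL-Analysis.Analysis" "HOL-Library.Poly_Mapping" "HOL-Library.Set_Algebras"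
begin

(* A = C[z_1^{+-1},...,z_d^{+-1}] is the group algebra of Z^d: finitely supported functions
   on exponent vectors, with the convolution product of Poly_Mapping.  Likewise A (x) A is the
   ring of Laurent polynomials in u, v, where u^\<alpha> v^\<beta> has exponent (\<alpha>, \<beta>). *)
type_synonym 'd laurent = "(int^'d) \<Rightarrow>\<^sub>0 complex"
type_synonym 'd laurent2 = "((int^'d) \<times> (int^'d)) \<Rightarrow>\<^sub>0 complex"

definition laurent_eval :: "'d::finite laurent \<Rightarrow> complex^'d \<Rightarrow> complex" where
  "laurent_eval p z =
     (\<Sum>\<alpha>\<in>Poly_Mapping.keys p. Poly_Mapping.lookup p \<alpha> * (\<Prod>j\<in>UNIV. (z $ j) powi (\<alpha> $ j)))"

definition exp_vec :: "real^'d::finite \<Rightarrow> complex^'d" where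
  "exp_vec \<omega> = (\<chi> j. exp (- \<i> * of_real (\<omega> $ j)))"

definition star :: "'d::finite laurent \<Rightarrow> 'd laurent" where
  "star p = (\<Sum>\<alpha>\<in>Poly_Mapping.keys p. Poly_Mapping.single (- \<alpha>) (cnj (Poly_Mapping.lookup p \<alpha>)))"

(* z^\<alpha> \<otimes> z^\<beta> is mapped to (z^\<beta>)^* \<otimes> (z^\<alpha>)^*: the two factors are swapped. *)
definition star2 :: "'d::finite laurent2 \<Rightarrow> 'd laurent2" where
  "star2 f = (\<Sum>(\<alpha>, \<beta>)\<in>Poly_Mapping.keys f.
     Poly_Mapping.single (- \<beta>, - \<alpha>) (cnj (Poly_Mapping.lookup f (\<alpha>, \<beta>))))"

definition tensor :: "'d::finite laurent \<Rightarrow> 'd laurent \<Rightarrow> 'd laurent2" where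
  "tensor p q = (\<Sum>\<alpha>\<in>Poly_Mapping.keys p. \<Sum>\<beta>\<in>Poly_Mapping.keys q.
     Poly_Mapping.single (\<alpha>, \<beta>) (Poly_Mapping.lookup p \<alpha> * Poly_Mapping.lookup q \<beta>))"

definition mu :: "'d::finite laurent2 \<Rightarrow> 'd laurent" where
  "mu f = (\<Sum>(\<alpha>, \<beta>)\<in>Poly_Mapping.keys f.
     Poly_Mapping.single (\<alpha> + \<beta>) (Poly_Mapping.lookup f (\<alpha>, \<beta>)))"

definition hermitian :: "'d::finite laurent2 \<Rightarrow> bool" where
  "hermitian f \<longleftrightarrow> star2 f = f"

definition expansive :: "int^'d::finite^'d \<Rightarrow> bool" where
  "expansive M \<longleftrightarrow> (\<forall>(e::complex) (v::complex^'d).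
     v \<noteq> 0 \<and> map_matrix of_int M *v v = e *s v \<longrightarrow> 1 < cmod e)"

(* G' = Z^d / M Z^d and G = 2 pi M^{-T} Z^d / 2 pi Z^d as sets of cosets.  Both are finite
   for expansive M, since det M is then nonzero.  The coset -\<xi> is the image uminus ` \<xi>. *)
definition cosets_G' :: "int^'d::finite^'d \<Rightarrow> (int^'d) set set" where
  "cosets_G' M = {\<alpha> +o range ((*v) M) | \<alpha>. True}"

definition two_pi_lattice :: "(real^'d::finite) set" where
  "two_pi_lattice = range (\<lambda>k :: int^'d. (2 * pi) *\<^sub>R (\<chi> j. of_int (k $ j)))"

definition cosets_G :: "int^'d::finite^'d \<Rightarrow> (real^'d) set set" where
  "cosets_G M = {(matrix_inv (transpose (map_matrix of_int M)) *v x) +o two_pi_lattice | x.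
            x \<in> two_pi_lattice}"

(* The coefficients of \<omega> \<mapsto> p(e^{-i(\<omega>+\<sigma>)}); see laurent_eval_twist. *)
definition twist :: "real^'d::finite \<Rightarrow> 'd laurent \<Rightarrow> 'd laurent" where
  "twist \<sigma> p = (\<Sum>\<alpha>\<in>Poly_Mapping.keys p. Poly_Mapping.single \<alpha>
     (Poly_Mapping.lookup p \<alpha> * exp (- \<i> * of_real (\<Sum>j\<in>UNIV. of_int (\<alpha> $ j) * \<sigma> $ j))))"

(* p^\<sigma> for a coset \<sigma>; independent of the representative, see twist_coset_eq. *)
definition twist_coset :: "'d::finite laurent \<Rightarrow> (real^'d) set \<Rightarrow> 'd laurent" where
  "twist_coset p S = twist (SOME \<sigma>. \<sigma> \<in> S) p"

definition monomial_span :: "'k set \<Rightarrow> ('k \<Rightarrow>\<^sub>0 complex) set" where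
  "monomial_span S = {(\<Sum>k\<in>F. Poly_Mapping.single k (c k)) | F c. finite F \<and> F \<subseteq> S}"

(* A_\<xi> \<otimes> A_\<eta>. *)
definition bigraded :: "(int^'d::finite) set \<Rightarrow> (int^'d) set \<Rightarrow> 'd laurent2 set" where
  "bigraded \<xi> \<eta> = monomial_span (\<xi> \<times> \<eta>)"

definition I_ideal :: "'d::finite laurent2 set" where
  "I_ideal = {f. mu f = 0}"

definition J_ideal :: "int^'d::finite^'d \<Rightarrow> 'd laurent2 set" where
  "J_ideal M = {(\<Sum>\<xi>\<in>cosets_G' M. \<Sum>\<eta>\<in>cosets_G' M. F \<xi> \<eta>) | F.
     \<forall>\<xi>\<in>cosets_G' M. \<forall>\<eta>\<in>cosets_G' M. F \<xi> \<eta> \<in> I_ideal \<inter> bigraded \<xi> \<eta>}"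


lemma lookup_sum_single:
  "finite F \<Longrightarrow> Poly_Mapping.lookup (\<Sum>k\<in>F. Poly_Mapping.single k (c k)) x =
     (if x \<in> F then c x else (0::'b::comm_monoid_add))"
  by (simp add: lookup_sum lookup_single when_def)

lemma lookup_star: "Poly_Mapping.lookup (star p) \<alpha> = cnj (Poly_Mapping.lookup p (- \<alpha>))"
proof -
  have eq: "(- x = \<alpha>) = (x = - \<alpha>)" for x by (metis add.inverse_inverse)
  show ?thesis
    unfolding star_def lookup_sum lookup_single when_def eq
    by (simp add: in_keys_iff)
qed

lemma lookup_star2:
  "Poly_Mapping.lookup (star2 f) (\<alpha>, \<beta>) = cnj (Poly_Mapping.lookup f (- \<beta>, - \<alpha>))"
proof -
  have eq: "((- snd x, - fst x) = (\<alpha>, \<beta>)) = (x = (- \<beta>, - \<alpha>))" for x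
    by (cases x) auto
  show ?thesis
    unfolding star2_def lookup_sum case_prod_unfold lookup_single when_def eq
    by (simp add: in_keys_iff)
qed

lemma lookup_tensor:
  "Poly_Mapping.lookup (tensor p q) (\<alpha>, \<beta>) = Poly_Mapping.lookup p \<alpha> * Poly_Mapping.lookup q \<beta>"
proof -
  have "Poly_Mapping.lookup (tensor p q) (\<alpha>, \<beta>) =
    (\<Sum>a\<in>Poly_Mapping.keys p. if a = \<alpha> then
       (\<Sum>b\<in>Poly_Mapping.keys q. if b = \<beta> then Poly_Mapping.lookup p a * Poly_Mapping.lookup q b else 0) else 0)"
    unfolding tensor_def lookup_sum lookup_single when_def
    by (intro sum.cong refl) auto
  then show ?thesis by (simp add: in_keys_iff)
qed

lemma star2_tensor: "star2 (tensor p q) = tensor (star q) (star p)"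
  by (rule poly_mapping_eqI) (auto simp: lookup_star2 lookup_tensor lookup_star)

lemma keys_tensor: "Poly_Mapping.keys (tensor p q) = Poly_Mapping.keys p \<times> Poly_Mapping.keys q"
  by (auto simp: in_keys_iff lookup_tensor)

lemma poly_mapping_sum_singles:
  "(\<Sum>k\<in>Poly_Mapping.keys p. Poly_Mapping.single k (Poly_Mapping.lookup p k)) = p"
  by (rule poly_mapping_eqI) (simp add: lookup_sum_single in_keys_iff)

lemma mu_tensor: "mu (tensor p q) = p * q"
proof -
  have "mu (tensor p q) = (\<Sum>\<alpha>\<in>Poly_Mapping.keys p. \<Sum>\<beta>\<in>Poly_Mapping.keys q.
      Poly_Mapping.single \<alpha> (Poly_Mapping.lookup p \<alpha>) * Poly_Mapping.single \<beta> (Poly_Mapping.lookup q \<beta>))"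
    unfolding mu_def keys_tensor by (simp add: lookup_tensor sum.cartesian_product mult_single)
  also have "\<dots> = p * q"
    by (simp add: sum_product [symmetric] poly_mapping_sum_singles)
  finally show ?thesis .
qed

lemma monomial_span_eq: "monomial_span S = {f. Poly_Mapping.keys f \<subseteq> S}"
proof (intro subset_antisym subsetI)
  fix f assume "f \<in> monomial_span S"
  then show "f \<in> {f. Poly_Mapping.keys f \<subseteq> S}"
    by (auto simp: monomial_span_def in_keys_iff lookup_sum_single split: if_splits)
next
  fix f :: "'a \<Rightarrow>\<^sub>0 complex" assume "f \<in> {f. Poly_Mapping.keys f \<subseteq> S}"
  then show "f \<in> monomial_span S"
    unfolding monomial_span_def mem_Collect_eq
    by (intro exI[of _ "Poly_Mapping.keys f"] exI[of _ "Poly_Mapping.lookup f"])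
       (simp add: poly_mapping_sum_singles)
qed

lemma lookup_twist:
  "Poly_Mapping.lookup (twist \<sigma> p) \<alpha> =
     Poly_Mapping.lookup p \<alpha> * exp (- \<i> * of_real (\<Sum>j\<in>UNIV. of_int (\<alpha> $ j) * \<sigma> $ j))"
  unfolding twist_def by (simp add: lookup_sum_single in_keys_iff)

lemma laurent_eval_twist: "laurent_eval (twist \<sigma> p) (exp_vec \<omega>) = laurent_eval p (exp_vec (\<omega> + \<sigma>))"
proof -
  have pw: "(\<Prod>j\<in>UNIV. (exp_vec x $ j) powi (\<alpha> $ j)) =
      exp (- \<i> * of_real (\<Sum>j\<in>UNIV. of_int (\<alpha> $ j) * x $ j))" for x :: "real^'a" and \<alpha>
  proof -
    have "(\<Prod>j\<in>UNIV. (exp_vec x $ j) powi (\<alpha> $ j)) =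
        (\<Prod>j\<in>UNIV. exp (- \<i> * of_real (of_int (\<alpha> $ j) * x $ j)))"
      unfolding exp_vec_def by (simp add: exp_power_int mult_ac)
    also have "\<dots> = exp (\<Sum>j\<in>UNIV. - \<i> * of_real (of_int (\<alpha> $ j) * x $ j))"
      by (simp add: exp_sum)
    also have "(\<Sum>j\<in>UNIV. - \<i> * complex_of_real (of_int (\<alpha> $ j) * x $ j)) =
        - \<i> * of_real (\<Sum>j\<in>UNIV. of_int (\<alpha> $ j) * x $ j)"
      unfolding of_real_sum sum_distrib_left ..
    finally show ?thesis .
  qed
  define e where "e x \<alpha> = exp (- \<i> * complex_of_real (\<Sum>j\<in>UNIV. of_int (\<alpha> $ j) * x $ j))"
    for x :: "real^'a" and \<alpha> :: "int^'a"
  have arg: "(\<Sum>j\<in>UNIV. real_of_int (\<alpha> $ j) * (\<omega> + \<sigma>) $ j) =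
      (\<Sum>j\<in>UNIV. of_int (\<alpha> $ j) * \<sigma> $ j) + (\<Sum>j\<in>UNIV. of_int (\<alpha> $ j) * \<omega> $ j)" for \<alpha>
    by (simp add: distrib_left sum.distrib)
  have e: "e \<sigma> \<alpha> * e \<omega> \<alpha> = e (\<omega> + \<sigma>) \<alpha>" for \<alpha>
    unfolding e_def arg of_real_add distrib_left exp_add ..
  have "Poly_Mapping.keys (twist \<sigma> p) = Poly_Mapping.keys p"
    by (auto simp: in_keys_iff lookup_twist)
  then show ?thesis
    unfolding laurent_eval_def pw lookup_twist e_def [symmetric]
    by (simp add: mult.assoc e)
qed

lemma twist_add_lattice:
  assumes "x \<in> two_pi_lattice" shows "twist (\<sigma> + x) p = twist \<sigma> p"
proof (rule poly_mapping_eqI)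
  fix \<alpha>
  obtain k :: "int^'a" where x: "x = (2 * pi) *\<^sub>R (\<chi> j. of_int (k $ j))"
    using assms by (auto simp: two_pi_lattice_def)
  define n where "n = (\<Sum>j\<in>UNIV. \<alpha> $ j * k $ j)"
  have "(\<Sum>j\<in>UNIV. of_int (\<alpha> $ j) * (\<sigma> + x) $ j) =
      (\<Sum>j\<in>UNIV. of_int (\<alpha> $ j) * \<sigma> $ j) + 2 * pi * of_int n"
    by (simp add: x n_def distrib_left sum.distrib sum_distrib_left mult_ac)
  then have "- \<i> * complex_of_real (\<Sum>j\<in>UNIV. of_int (\<alpha> $ j) * (\<sigma> + x) $ j) =
      - \<i> * of_real (\<Sum>j\<in>UNIV. of_int (\<alpha> $ j) * \<sigma> $ j) + of_int (2 * - n) * (of_real pi * \<i>)"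
    by (simp only: of_real_add) (simp add: distrib_left)
  then have "exp (- \<i> * complex_of_real (\<Sum>j\<in>UNIV. of_int (\<alpha> $ j) * (\<sigma> + x) $ j)) =
      exp (- \<i> * of_real (\<Sum>j\<in>UNIV. of_int (\<alpha> $ j) * \<sigma> $ j))"
    unfolding exp_eq by (intro exI [of _ "- n"]) (simp only: of_int_mult of_int_numeral of_real_mult of_real_numeral mult_ac of_real_of_int_eq)
  then show "Poly_Mapping.lookup (twist (\<sigma> + x) p) \<alpha> = Poly_Mapping.lookup (twist \<sigma> p) \<alpha>"
    by (simp only: lookup_twist)
qed

lemma twist_coset_eq:
  assumes "S \<in> cosets_G M" "\<sigma> \<in> S"
  shows "twist_coset p S = twist \<sigma> p"
proof -
  obtain s where S: "S = s +o two_pi_lattice" using assms(1) by (auto simp: cosets_G_def)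
  have "twist t p = twist s p" if "t \<in> S" for t
    using that twist_add_lattice by (auto simp: S elt_set_plus_def)
  then show ?thesis
    unfolding twist_coset_def using assms(2) someI[of "\<lambda>x. x \<in> S"] by metis
qed

end

theory Submission
  imports Defs
begin

text \<open>
  Write \<open>m = \<bar>det M\<bar>\<close>, and for an exponent coset \<open>\<xi>\<close> let \<open>part \<xi> p\<close> be the component of \<open>p\<close> of
  degree \<open>\<xi>\<close>. All three conditions are equivalent to the existence of a decomposition
  \<open>\<delta>(\<xi>, \<eta>) / m - (part \<xi> p)\<^sup>* part \<eta> p = \<Sum>\<^sub>j (part \<xi> q\<^sub>j)\<^sup>* part \<eta> q\<^sub>j\<close> that holds for all cosets \<open>\<xi>\<close>, \<open>\<eta>\<close>
  simultaneously, the predicate \<open>polyphase_sos\<close>.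

  Condition (ii) is this decomposition read in the tensor square. An element lies in the ideal \<open>J\<close>
  exactly when \<open>\<mu>\<close> annihilates each of its bihomogeneous components, and applying \<open>\<mu>\<close> to the component
  of degree \<open>(-\<xi>, \<eta>)\<close> of the congruence gives the displayed identity, whatever the lifts \<open>h\<close> are
  (\<open>J_congruence_iff_polyphase_sos\<close>). Since at least one admissible family of lifts exists, quantifying
  over all of them changes nothing.

  Condition (iii) is its Fourier transform. The twists of \<open>p\<close> are \<open>p\<^sup>\<sigma> = \<Sum>\<^sub>\<xi> \<xi>(\<sigma>) part \<xi> p\<close>, and the two
  groups are dual to each other: the rows and the columns of the character table are orthogonal with
  square norm \<open>m\<close> (\<open>polyphase_sos_iff_twist\<close>). This is the place where both groups must have order
  \<open>m\<close>. The index of \<open>M \<int>\<^sup>d\<close> in \<open>\<int>\<^sup>d\<close> is computed as a volume: the image of the unit cube under \<open>M\<close> and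
  a union of translated unit cubes, one for each coset, are fundamental domains of the same lattice.

  Let \<open>v\<close> be the column with the entries \<open>p\<^sup>\<sigma>\<^sup>*\<close>, so that \<open>f = 1 - v\<^sup>*v\<close> and the matrix in (iii) is
  \<open>1 - vv\<^sup>*\<close>. From (iii) to (i) one uses \<open>f = f\<^sup>2 + v\<^sup>*(1 - vv\<^sup>*)v\<close>. From (i) one goes back with
  \<open>1 - vv\<^sup>* = (1 - vv\<^sup>*)\<^sup>2 + v f v\<^sup>*\<close>, but now the rows on the right must be of the form \<open>(q\<^sup>\<tau>)\<^sub>\<tau>\<close> for a
  Laurent polynomial \<open>q\<close>. In terms of homogeneous components this only asks for the right degrees:
  multiplication by a monomial corrects the degree of each row and cancels in the product with the
  adjoint (\<open>sos_imp_polyphase_sos\<close>).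
\<close>

section \<open>Volume of linear images\<close>

lemma det_map_of_int:
  "det (map_matrix of_int M :: 'a::comm_ring_1^'n^'n) = of_int (det M)"
  by (simp add: det_def)

text \<open>The matrix arises from the identity by adding one row to another.\<close>

lemma det_shear:
  fixes m n :: "'n::finite"
  assumes "m \<noteq> n"
  shows "det (matrix (\<lambda>x::real^'n. \<chi> i. if i = m then x$m + x$n else x$i)) = 1"
proof -
  have "matrix (\<lambda>x::real^'n. \<chi> i. if i = m then x$m + x$n else x$i)
      = (\<chi> k. if k = m then row m (mat 1) + 1 *s row n (mat 1) else row k (mat 1))"
    by (auto simp: matrix_def vec_eq_iff axis_def mat_def row_def)
  then show ?thesis
    using det_row_operation[OF assms, of "mat 1" 1] by simp
qed

text \<open>Every linear map is a product of elementary ones, so it suffices to treat singular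
  maps, diagonal maps, coordinate swaps and shears. The type of indices carries no order here, so
  no matrix can be called triangular; the determinant of a shear comes from row operations
  instead.\<close>

proposition measure_linear_image_det:
  fixes f :: "real^'n \<Rightarrow> real^'n"
  assumes "linear f" "S \<in> lmeasurable"
  shows "f ` S \<in> lmeasurable \<and> measure lebesgue (f ` S) = \<bar>det (matrix f)\<bar> * measure lebesgue S"
proof -
  let ?P = "\<lambda>f. \<forall>S\<in>lmeasurable. f ` S \<in> lmeasurable \<and>
      measure lebesgue (f ` S) = \<bar>det (matrix f)\<bar> * measure lebesgue S"
  have box_preserving: "?P f" if lin: "linear f" and det: "\<bar>det (matrix f)\<bar> = 1"
    and box: "\<And>a b. measure lebesgue (f ` cbox a b) = measure lebesgue (cbox a b)"
    for f :: "real^'n \<Rightarrow> real^'n"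
  proof
    fix S :: "(real^'n) set" assume S: "S \<in> lmeasurable"
    have "measure lebesgue (f ` cbox a b) = 1 * measure lebesgue (cbox a b)" for a b
      by (simp add: box)
    from measure_linear_sufficient[OF lin S this]
    show "f ` S \<in> lmeasurable \<and> measure lebesgue (f ` S) = \<bar>det (matrix f)\<bar> * measure lebesgue S"
      by (simp add: det)
  qed
  have "?P f"
  proof (rule induct_linear_elementary[where P = ?P, OF \<open>linear f\<close>])
    fix f g :: "real^'n \<Rightarrow> real^'n"
    assume lin: "linear f" "linear g" and f: "?P f" and g: "?P g"
    show "?P (f \<circ> g)"
    proof
      fix S :: "(real^'n) set" assume S: "S \<in> lmeasurable"
      have gS: "g ` S \<in> lmeasurable" "measure lebesgue (g ` S) = \<bar>det (matrix g)\<bar> * measure lebesgue S"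
        using g S by blast+
      have fgS: "f ` g ` S \<in> lmeasurable"
        "measure lebesgue (f ` g ` S) = \<bar>det (matrix f)\<bar> * measure lebesgue (g ` S)"
        using f gS(1) by blast+
      show "(f \<circ> g) ` S \<in> lmeasurable \<and>
          measure lebesgue ((f \<circ> g) ` S) = \<bar>det (matrix (f \<circ> g))\<bar> * measure lebesgue S"
        unfolding image_comp[symmetric] matrix_compose[OF lin(2,1)] det_mul abs_mult
        using fgS gS(2) by simp
    qed
  next
    fix f :: "real^'n \<Rightarrow> real^'n" and i
    assume lin: "linear f" and zero: "\<And>x. f x $ i = 0"
    have neg: "negligible (f ` S)" for S
      by (rule negligible_subset[OF negligible_standard_hyperplane_cart[of i]]) (use zero in auto)
    have "row i (matrix f) = 0"
      by (simp add: row_def matrix_def zero vec_eq_iff)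
    then have "det (matrix f) = 0" by (rule det_zero_row)
    with neg show "?P f"
      by (auto simp: negligible_iff_measure)
  next
    fix c :: "'n \<Rightarrow> real"
    have "det (matrix (\<lambda>x. \<chi> i. c i * x $ i)) = prod c UNIV"
      by (subst det_diagonal) (auto simp: matrix_def axis_def)
    then show "?P (\<lambda>x. \<chi> i. c i * x $ i)"
      by (simp add: measurable_stretch measure_stretch)
  next
    fix m n :: 'n assume "m \<noteq> n"
    let ?t = "Transposition.transpose m n"
    let ?h = "\<lambda>x::real^'n. \<chi> i. x $ ?t i"
    have lin: "linear ?h"
      by (rule linearI) (simp_all add: vec_eq_iff)
    have image: "?h ` cbox a b = cbox (?h a) (?h b)" for a b
    proof
      show "?h ` cbox a b \<subseteq> cbox (?h a) (?h b)"
        by (auto simp: mem_box_cart)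
      have "x = ?h (?h x)" for x
        by (simp add: vec_eq_iff)
      moreover have "?h x \<in> cbox a b" if "x \<in> cbox (?h a) (?h b)" for x
        using that unfolding mem_box_cart by (metis transpose_involutory vec_lambda_beta)
      ultimately show "cbox (?h a) (?h b) \<subseteq> ?h ` cbox a b"
        by blast
    qed
    have "measure lebesgue (cbox (?h a) (?h b)) = measure lebesgue (cbox a b)" for a b
    proof -
      have "cbox (?h a) (?h b) = {} \<longleftrightarrow> cbox a b = {}"
        unfolding interval_eq_empty_cart by (metis transpose_involutory vec_lambda_beta)
      then show ?thesis
        using prod.permute[OF permutes_swap_id, of m UNIV n "\<lambda>i. b $ i - a $ i"]
        by (simp add: content_cbox_if_cart o_def)
    qed
    then have "measure lebesgue (?h ` cbox a b) = measure lebesgue (cbox a b)" for a b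
      unfolding image .
    then show "?P ?h"
    proof (rule box_preserving[OF lin, rotated])
      have "matrix ?h = (\<chi> i. mat 1 $ ?t i)"
        by (auto simp: matrix_def vec_eq_iff axis_def mat_def)
      then show "\<bar>det (matrix ?h)\<bar> = 1"
        by (simp add: det_permute_rows permutes_swap_id sign_swap_id abs_mult)
    qed
  next
    fix m n :: 'n assume mn: "m \<noteq> n"
    let ?h = "\<lambda>x::real^'n. \<chi> i. if i = m then x$m + x$n else x$i"
    have lin: "linear ?h"
      by (rule linearI) (auto simp: vec_eq_iff distrib_left)
    have "measure lebesgue (?h ` cbox a b) = measure lebesgue (cbox a b)" for a b
    proof (cases "cbox a b = {}")
      case False
      \<comment> \<open>Translate the box so that its \<open>n\<close>-th lower bound becomes \<open>0\<close>, as \<open>measure_shear_interval\<close> requires.\<close>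
      define v where "v = axis n (a $ n)"
      define C where "C = cbox (a - v) (b - v)"
      have box: "cbox a b = (+) v ` C"
        by (simp add: C_def cbox_translation[symmetric])
      have "?h ` cbox a b = (+) (?h v) ` ?h ` C"
        unfolding box image_image
      proof (rule image_cong[OF refl])
        show "?h (v + x) = ?h v + ?h x" for x by (rule linear_add[OF lin])
      qed
      then have "measure lebesgue (?h ` cbox a b) = measure lebesgue (?h ` C)"
        by (simp only: measure_translation)
      also have "\<dots> = measure lebesgue C"
        unfolding C_def
      proof (rule measure_shear_interval[OF mn])
        show "cbox (a - v) (b - v) \<noteq> {}" using False box C_def by auto
      qed (simp add: v_def)
      finally show ?thesis
        by (simp only: box measure_translation)
    qed simp
    then show "?P ?h"
      by (rule box_preserving[rotated 2]) (rule lin, simp only: det_shear[OF mn] abs_one)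
  qed
  with assms(2) show ?thesis by blast
qed

section \<open>Cosets and their representatives\<close>

text \<open>The choice agrees with the one made for \<open>twist_coset\<close>, so that a twist by
  a coset is by definition the twist by this representative.\<close>

definition coset_rep :: "'a set \<Rightarrow> 'a" where
  "coset_rep c = (SOME x. x \<in> c)"

text \<open>For a subset of an abelian group: to be a subgroup.\<close>

definition diff_closed :: "'a::ab_group_add set \<Rightarrow> bool" where
  "diff_closed L \<longleftrightarrow> 0 \<in> L \<and> (\<forall>x\<in>L. \<forall>y\<in>L. x - y \<in> L)"

lemma mem_coset_iff: "y \<in> x +o L \<longleftrightarrow> y - x \<in> (L :: 'a::ab_group_add set)"
  by (auto simp: elt_set_plus_def intro: bexI[of _ "y - x"])

lemma coset_eq_iff:
  assumes "diff_closed L"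
  shows "x +o L = y +o L \<longleftrightarrow> x - y \<in> L"
proof
  assume "x +o L = y +o L"
  moreover have "x \<in> x +o L" using assms by (simp add: mem_coset_iff diff_closed_def)
  ultimately show "x - y \<in> L" by (simp add: mem_coset_iff)
next
  assume xy: "x - y \<in> L"
  have "z - y \<in> L \<longleftrightarrow> z - x \<in> L" for z
  proof
    assume "z - y \<in> L"
    then have "(z - y) - (x - y) \<in> L" using assms xy unfolding diff_closed_def by blast
    then show "z - x \<in> L" by simp
  next
    assume "z - x \<in> L"
    moreover have "0 - (x - y) \<in> L" using assms xy unfolding diff_closed_def by blast
    ultimately have "(z - x) - (0 - (x - y)) \<in> L" using assms unfolding diff_closed_def by blast
    then show "z - y \<in> L" by simp
  qed
  then show "x +o L = y +o L" by (auto simp: mem_coset_iff)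
qed

lemma coset_rep_diff:
  assumes "diff_closed L"
  shows "coset_rep (x +o L) - x \<in> L"
proof -
  have "x \<in> x +o L" using assms by (simp add: mem_coset_iff diff_closed_def)
  then have "coset_rep (x +o L) \<in> x +o L" unfolding coset_rep_def by (rule someI)
  then show ?thesis by (simp add: mem_coset_iff)
qed

lemma coset_rep_coset:
  assumes "diff_closed L"
  shows "coset_rep (x +o L) +o L = x +o L"
  using coset_rep_diff[OF assms] coset_eq_iff[OF assms] by blast

section \<open>The index of a lattice as a volume\<close>

text \<open>The translates of \<open>F\<close> by the elements of \<open>L\<close> partition the
  space, that is, \<open>F\<close> is a fundamental domain of \<open>L\<close>.\<close>

definition tiles :: "'a::ab_group_add set \<Rightarrow> 'a set \<Rightarrow> bool" where
  "tiles F L \<longleftrightarrow> (\<forall>x. \<exists>!l. l \<in> L \<and> x - l \<in> F)"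

text \<open>Cut \<open>F1\<close> along the translates of \<open>F2\<close> and move each piece
  back into \<open>F2\<close>. The moved pieces are disjoint since the translates of
  \<open>F1\<close> are. Exchanging the two sets shows that all fundamental domains of a lattice
  have the same volume.\<close>

lemma emeasure_tiles_le:
  fixes F1 F2 :: "'a::euclidean_space set"
  assumes "countable L" "\<And>l. l \<in> L \<Longrightarrow> - l \<in> L"
    and F: "tiles F1 L" "tiles F2 L" "F1 \<in> sets lebesgue" "F2 \<in> sets lebesgue"
  shows "emeasure lebesgue F1 \<le> emeasure lebesgue F2"
proof -
  have tr: "emeasure lebesgue ((+) a ` S) = emeasure lebesgue S" for a and S :: "'a set"
    using emeasure_lebesgue_affine[of 1 a S] by (simp add: add.commute cong: image_cong_simp)
  define X where "X l = F1 \<inter> (+) l ` F2" for l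
  define Y where "Y l = (+) (- l) ` X l" for l
  have X: "X l \<in> sets lebesgue" for l
    unfolding X_def using F lebesgue_sets_translation by blast
  have Y: "Y l \<in> sets lebesgue" for l
    unfolding Y_def by (intro lebesgue_sets_translation X)
  have memX: "x \<in> X l \<longleftrightarrow> x \<in> F1 \<and> x - l \<in> F2" for x l
    unfolding X_def by (auto simp: image_iff algebra_simps intro: bexI[of _ "x - l"])
  have memY: "x \<in> Y l \<longleftrightarrow> x - (- l) \<in> F1 \<and> x \<in> F2" for x l
    unfolding Y_def image_iff Bex_def memX
    by (auto simp: algebra_simps intro: exI[of _ "x + l"])
  have dX: "disjoint_family_on X L"
    using F(2) unfolding disjoint_family_on_def tiles_def by (fastforce simp: memX)
  have dY: "disjoint_family_on Y L"
    unfolding disjoint_family_on_def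
  proof (intro ballI impI)
    fix l k assume "l \<in> L" "k \<in> L" "l \<noteq> k"
    then show "Y l \<inter> Y k = {}"
      using F(1) assms(2) unfolding tiles_def by (metis (no_types, lifting) disjoint_iff memY neg_equal_iff_equal)
  qed
  have "F1 = (\<Union>l\<in>L. X l)"
  proof
    show "F1 \<subseteq> (\<Union>l\<in>L. X l)"
    proof
      fix x assume "x \<in> F1"
      moreover obtain l where "l \<in> L" "x - l \<in> F2" using F(2) unfolding tiles_def by blast
      ultimately show "x \<in> (\<Union>l\<in>L. X l)" by (auto simp: memX)
    qed
  qed (auto simp: memX)
  then have "emeasure lebesgue F1 = (\<integral>\<^sup>+l. emeasure lebesgue (X l) \<partial>count_space L)"
    using emeasure_UN_countable[OF X assms(1) dX] by simp
  also have "\<dots> = (\<integral>\<^sup>+l. emeasure lebesgue (Y l) \<partial>count_space L)"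
    unfolding Y_def tr ..
  also have "\<dots> = emeasure lebesgue (\<Union>l\<in>L. Y l)"
    using emeasure_UN_countable[OF Y assms(1) dY] by simp
  also have "\<dots> \<le> emeasure lebesgue F2"
    by (rule emeasure_mono) (auto simp: memY F)
  finally show ?thesis .
qed

abbreviation vec_real :: "int^'n::finite \<Rightarrow> real^'n" where
  "vec_real k \<equiv> (\<chi> i. of_int (k $ i))"

definition unit_cube :: "(real^'n::finite) set" where
  "unit_cube = {x. \<forall>i. 0 \<le> x $ i \<and> x $ i < 1}"

lemma unit_cube_measure:
  "unit_cube \<in> (lmeasurable :: (real^'n::finite) set set)" "measure lebesgue (unit_cube :: (real^'n::finite) set) = 1"
proof -
  have sub: "box 0 1 \<subseteq> (unit_cube :: (real^'n) set)" "unit_cube \<subseteq> cbox 0 (1 :: real^'n)"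
    unfolding unit_cube_def mem_box_cart subset_iff mem_Collect_eq zero_index one_index
    by (blast intro: less_imp_le)+
  have neg: "negligible (cbox 0 1 - unit_cube \<union> (unit_cube - cbox 0 1) :: (real^'n) set)"
    by (rule negligible_subset[OF negligible_frontier_interval[of 0 1]]) (use sub in auto)
  then show "unit_cube \<in> (lmeasurable :: (real^'n) set set)"
    by (rule lmeasurable_negligible_symdiff[OF lmeasurable_cbox])
  have "measure lebesgue (cbox 0 (1 :: real^'n)) = 1"
    by (auto simp: content_cbox_if_cart interval_eq_empty_cart)
  then show "measure lebesgue (unit_cube :: (real^'n::finite) set) = 1"
    using measure_negligible_symdiff[OF lmeasurable_cbox neg] by (simp add: Un_commute)
qed

lemma tiles_unit_cube: "\<exists>!k. x - vec_real k \<in> unit_cube"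
proof
  show "x - vec_real (\<chi> i. \<lfloor>x $ i\<rfloor>) \<in> unit_cube"
    by (auto simp: unit_cube_def) linarith
  show "k = (\<chi> i. \<lfloor>x $ i\<rfloor>)" if "x - vec_real k \<in> unit_cube" for k
  proof -
    have "0 \<le> x $ i - of_int (k $ i) \<and> x $ i - of_int (k $ i) < 1" for i
      using that by (simp add: unit_cube_def)
    then have "\<lfloor>x $ i\<rfloor> = k $ i" for i
      by (intro floor_unique) (smt (verit))+
    then show ?thesis by (simp add: vec_eq_iff)
  qed
qed

lemma map_matrix_of_int_mult:
  "map_matrix of_int M *v vec_real k = vec_real (M *v k)"
  by (simp add: matrix_vector_mult_def vec_eq_iff)

text \<open>Apply the inverse matrix: the integer part of \<open>A\<^sup>-\<^sup>1 x\<close>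
  determines the lattice vector.\<close>

lemma tiles_linear_image:
  fixes A :: "real^'n::finite^'n"
  assumes "invertible A"
  shows "tiles ((*v) A ` unit_cube) (range (\<lambda>k. A *v vec_real k))"
  unfolding tiles_def
proof
  fix x :: "real^'n"
  obtain B where B: "A ** B = mat 1" "B ** A = mat 1" using assms invertible_def by blast
  have AB: "A *v (B *v y) = y" "B *v (A *v y) = y" for y
    using B by (simp_all add: matrix_vector_mul_assoc)
  have injA: "inj ((*v) A)" by (rule inj_on_inverseI[where g = "(*v) B"]) (rule AB(2))
  have iff: "x - A *v vec_real k \<in> (*v) A ` unit_cube \<longleftrightarrow> B *v x - vec_real k \<in> unit_cube" for k
  proof -
    have "x - A *v vec_real k = A *v (B *v x - vec_real k)"
      by (simp only: matrix_vector_mult_diff_distrib AB)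
    then show ?thesis by (simp only: inj_image_mem_iff[OF injA])
  qed
  obtain k where k: "B *v x - vec_real k \<in> unit_cube"
      and uk: "\<And>k'. B *v x - vec_real k' \<in> unit_cube \<Longrightarrow> k' = k"
    using tiles_unit_cube by blast
  show "\<exists>!l. l \<in> range (\<lambda>k. A *v vec_real k) \<and> x - l \<in> (*v) A ` unit_cube"
  proof (rule ex1I[of _ "A *v vec_real k"])
    show "A *v vec_real k \<in> range (\<lambda>k. A *v vec_real k) \<and> x - A *v vec_real k \<in> (*v) A ` unit_cube"
      using k iff by blast
    show "l = A *v vec_real k"
      if l: "l \<in> range (\<lambda>k. A *v vec_real k) \<and> x - l \<in> (*v) A ` unit_cube" for l
    proof -
      obtain k' where k': "l = A *v vec_real k'" using l by blast
      then have "k' = k" using l iff uk by blast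
      then show ?thesis by (simp only: k')
    qed
  qed
qed

text \<open>One unit cube for each coset; together the cubes tile the space under the
  subgroup.\<close>

definition coset_cube :: "(int^'n::finite) set \<Rightarrow> (real^'n) set" where
  "coset_cube c = (+) (vec_real (coset_rep c)) ` unit_cube"

lemma mem_coset_cube: "x \<in> coset_cube c \<longleftrightarrow> x - vec_real (coset_rep c) \<in> unit_cube"
proof
  assume "x - vec_real (coset_rep c) \<in> unit_cube"
  then have "vec_real (coset_rep c) + (x - vec_real (coset_rep c)) \<in> coset_cube c"
    unfolding coset_cube_def by (rule imageI)
  then show "x \<in> coset_cube c" by simp
qed (auto simp: coset_cube_def)

lemma coset_cube_disjoint:
  assumes "diff_closed R"
  shows "disjoint_family_on coset_cube (range (\<lambda>\<alpha>. \<alpha> +o R))"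
proof -
  have "\<alpha> +o R = \<beta> +o R" if "x \<in> coset_cube (\<alpha> +o R)" "x \<in> coset_cube (\<beta> +o R)" for \<alpha> \<beta> x
  proof -
    have "coset_rep (\<alpha> +o R) = coset_rep (\<beta> +o R)"
      using that tiles_unit_cube unfolding mem_coset_cube by blast
    then show ?thesis using coset_rep_coset[OF assms] by metis
  qed
  then show ?thesis unfolding disjoint_family_on_def by blast
qed

text \<open>The cube that contains a point is given by an integer vector \<open>k\<close>, and
  \<open>k\<close> is uniquely an element of the subgroup plus the chosen representative of its
  coset.\<close>

lemma tiles_coset_cubes:
  fixes R :: "(int^'n::finite) set"
  assumes R: "diff_closed R"
  shows "tiles (\<Union>c\<in>range (\<lambda>\<alpha>. \<alpha> +o R). coset_cube c) (vec_real ` R)"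
  unfolding tiles_def
proof
  fix x :: "real^'n"
  let ?F = "\<Union>c\<in>range (\<lambda>\<alpha>. \<alpha> +o R). coset_cube c"
  obtain k where k: "x - vec_real k \<in> unit_cube"
    and uk: "\<And>k'. x - vec_real k' \<in> unit_cube \<Longrightarrow> k' = k"
    using tiles_unit_cube by blast
  define r0 where "r0 = k - coset_rep (k +o R)"
  have "0 - (coset_rep (k +o R) - k) \<in> R"
    using coset_rep_diff[OF R] R unfolding diff_closed_def by blast
  then have r0: "r0 \<in> R" by (simp add: r0_def)
  have split: "x - vec_real r - vec_real s = x - vec_real (r + s)" for r s
    by (simp add: vec_eq_iff)
  have r0F: "x - vec_real r0 \<in> ?F"
  proof -
    have "x - vec_real r0 \<in> coset_cube (k +o R)"
      using k unfolding mem_coset_cube split r0_def by simp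
    then show ?thesis by blast
  qed
  have unique: "r = r0" if r: "r \<in> R" and F: "x - vec_real r \<in> ?F" for r
  proof -
    obtain \<alpha> where "x - vec_real r \<in> coset_cube (\<alpha> +o R)" using F by blast
    then have k': "r + coset_rep (\<alpha> +o R) = k"
      unfolding mem_coset_cube split by (rule uk)
    have "k +o R = coset_rep (\<alpha> +o R) +o R"
      unfolding coset_eq_iff[OF R] using r by (simp add: k'[symmetric])
    then have "coset_rep (k +o R) = coset_rep (\<alpha> +o R)"
      by (simp only: coset_rep_coset[OF R])
    then show "r = r0" using k' by (simp add: r0_def eq_diff_eq)
  qed
  show "\<exists>!l. l \<in> vec_real ` R \<and> x - l \<in> ?F"
    by (rule ex1I[of _ "vec_real r0"]) (use r0 r0F unique in blast)+
qed

lemma emeasure_coset_cubes: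
  fixes R :: "(int^'n::finite) set"
  assumes R: "diff_closed R"
  shows "(\<Union>c\<in>range (\<lambda>\<alpha>. \<alpha> +o R). coset_cube c) \<in> sets lebesgue"
    and "emeasure lebesgue (\<Union>c\<in>range (\<lambda>\<alpha>. \<alpha> +o R). coset_cube c)
      = emeasure (count_space (range (\<lambda>\<alpha>. \<alpha> +o R))) (range (\<lambda>\<alpha>. \<alpha> +o R))"
proof -
  let ?C = "range (\<lambda>\<alpha>. \<alpha> +o R)"
  have cube: "coset_cube c \<in> lmeasurable" "measure lebesgue (coset_cube c) = 1"
    for c :: "(int^'n) set"
    unfolding coset_cube_def by (simp_all add: measurable_translation measure_translation unit_cube_measure)
  then have sets: "coset_cube c \<in> sets lebesgue" for c :: "(int^'n) set"
    by (simp add: fmeasurableD)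
  have em: "emeasure lebesgue (coset_cube c) = 1" for c :: "(int^'n) set"
    using cube[of c] by (simp add: emeasure_eq_measure2)
  have countable: "countable ?C" by simp
  then show "(\<Union>c\<in>?C. coset_cube c) \<in> sets lebesgue"
    by (rule sets.countable_UN'') (rule sets)
  have "emeasure lebesgue (\<Union>c\<in>?C. coset_cube c) = (\<integral>\<^sup>+c. emeasure lebesgue (coset_cube c) \<partial>count_space ?C)"
    by (rule emeasure_UN_countable[OF sets countable coset_cube_disjoint[OF R]])
  also have "\<dots> = emeasure (count_space ?C) ?C"
    unfolding em by simp
  finally show "emeasure lebesgue (\<Union>c\<in>?C. coset_cube c) = emeasure (count_space ?C) ?C" .
qed

lemma diff_closed_range_matrix:
  fixes M :: "'a::ring_1^'n::finite^'m::finite"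
  shows "diff_closed (range ((*v) M))"
proof -
  have "M *v k - M *v l \<in> range ((*v) M)" for k l
    unfolding matrix_vector_mult_diff_distrib[symmetric] by blast
  moreover have "0 \<in> range ((*v) M)" by (rule range_eqI[of _ _ 0]) simp
  ultimately show ?thesis unfolding diff_closed_def by blast
qed

lemma cosets_G'_eq: "cosets_G' M = range (\<lambda>\<alpha>. \<alpha> +o range ((*v) M))"
  unfolding cosets_G'_def by blast

text \<open>The image of the unit cube has volume \<open>\<bar>det M\<bar>\<close>, the cubes of
  the cosets have total volume equal to the number of cosets, and both sets are fundamental
  domains of \<open>M \<int>\<^sup>n\<close>. Finiteness of the group comes out at the same time,
  since the volume is finite.\<close>

theorem card_cosets_G':
  fixes M :: "int^'n::finite^'n"
  assumes "det M \<noteq> 0"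
  shows "finite (cosets_G' M)" and "of_nat (card (cosets_G' M)) = \<bar>det M\<bar>"
proof -
  let ?A = "map_matrix of_int M :: real^'n^'n"
  let ?R = "range ((*v) M)"
  let ?L = "range (\<lambda>k. ?A *v vec_real k)"
  have L: "?L = vec_real ` ?R"
    unfolding map_matrix_of_int_mult image_image ..
  have neg: "- l \<in> ?L" if l: "l \<in> ?L" for l
  proof -
    obtain k where k: "l = ?A *v vec_real k" using l by blast
    have "vec_real (- k) = - vec_real k" by (simp add: vec_eq_iff)
    then have "- l = ?A *v vec_real (- k)"
      using matrix_vector_mult_diff_distrib[of ?A 0 "vec_real k"] by (simp add: k)
    then show ?thesis by (rule range_eqI)
  qed
  have "invertible ?A"
    using assms by (simp add: invertible_det_nz det_map_of_int)
  note tiles = tiles_linear_image[OF this] tiles_coset_cubes[OF diff_closed_range_matrix[of M], folded L]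
  have F1: "(*v) ?A ` unit_cube \<in> lmeasurable"
    "measure lebesgue ((*v) ?A ` unit_cube) = \<bar>of_int (det M)\<bar>"
    using measure_linear_image_det[OF matrix_vector_mul_linear[of ?A] unit_cube_measure(1)]
    by (simp_all add: unit_cube_measure det_map_of_int)
  have sets: "(*v) ?A ` unit_cube \<in> sets lebesgue" using F1(1) by (rule fmeasurableD)
  note cubes = emeasure_coset_cubes[OF diff_closed_range_matrix[of M], folded cosets_G'_eq]
  have "ennreal \<bar>of_int (det M)\<bar> = emeasure lebesgue ((*v) ?A ` unit_cube)"
    unfolding emeasure_eq_measure2[OF F1(1)] F1(2) ..
  also have "\<dots> = emeasure lebesgue (\<Union>c\<in>cosets_G' M. coset_cube c)"
    by (rule antisym; rule emeasure_tiles_le[of ?L])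
       (use neg tiles[folded cosets_G'_eq] sets cubes(1) in auto)
  also have "\<dots> = emeasure (count_space (cosets_G' M)) (cosets_G' M)"
    by (rule cubes(2))
  finally have eq: "ennreal \<bar>of_int (det M)\<bar> = emeasure (count_space (cosets_G' M)) (cosets_G' M)" .
  show fin: "finite (cosets_G' M)"
  proof (rule ccontr)
    assume "infinite (cosets_G' M)"
    then have "emeasure (count_space (cosets_G' M)) (cosets_G' M) = \<infinity>"
      by (simp add: emeasure_count_space)
    with eq show False by simp
  qed
  then have "ennreal \<bar>of_int (det M)\<bar> = ennreal (of_nat (card (cosets_G' M)))"
    using eq by (simp add: emeasure_count_space_finite ennreal_of_nat_eq_real_of_nat)
  then have "\<bar>real_of_int (det M)\<bar> = of_nat (card (cosets_G' M))"
    by (subst (asm) ennreal_inj) auto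
  then show "of_nat (card (cosets_G' M)) = \<bar>det M\<bar>" by linarith
qed

section \<open>Characters and duality of the two finite groups\<close>

text \<open>Otherwise \<open>0\<close> would be an eigenvalue.\<close>

lemma expansive_det_nonzero:
  fixes M :: "int^'n::finite^'n"
  assumes "expansive M"
  shows "det M \<noteq> 0"
proof
  assume "det M = 0"
  let ?A = "map_matrix of_int M :: complex^'n^'n"
  have "det ?A = 0" using \<open>det M = 0\<close> by (simp add: det_map_of_int)
  then have "\<not> invertible ?A" by (simp add: invertible_det_nz)
  then obtain v where "v \<noteq> 0" "?A *v v = 0"
    unfolding invertible_left_inverse matrix_left_invertible_ker by blast
  then have "v \<noteq> 0 \<and> ?A *v v = 0 *s v" by simp
  then have "1 < cmod 0" using assms unfolding expansive_def by blast
  then show False by simp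
qed

text \<open>If \<open>f t \<noteq> 1\<close> for some \<open>t\<close>, then translation by
  \<open>t\<close> permutes the cosets and multiplies the sum by \<open>f t\<close>, so the sum
  vanishes. The lemma serves both groups, whose cosets live in different ambient groups.\<close>

lemma sum_character_cosets:
  fixes f :: "'a::ab_group_add \<Rightarrow> complex"
  assumes L: "diff_closed L" and K: "diff_closed K"
    and f: "\<And>x y. f (x + y) = f x * f y" "\<And>l. l \<in> L \<Longrightarrow> f l = 1"
  defines "C \<equiv> (\<lambda>x. x +o L) ` K"
  shows "(\<Sum>c\<in>C. f (coset_rep c)) = (if \<forall>x\<in>K. f x = 1 then of_nat (card C) else 0)"
proof -
  have rep: "f (coset_rep (x +o L)) = f x" for x
    using f(1)[of "coset_rep (x +o L) - x" x] f(2)[OF coset_rep_diff[OF L, of x]] by simp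
  show ?thesis
  proof (cases "\<forall>x\<in>K. f x = 1")
    case True
    then have "(\<Sum>c\<in>C. f (coset_rep c)) = (\<Sum>c\<in>C. 1)"
      by (intro sum.cong refl) (auto simp: C_def rep)
    with True show ?thesis by simp
  next
    case False
    then obtain t where t: "t \<in> K" "f t \<noteq> 1" by blast
    have K0: "0 - t \<in> K" using K t unfolding diff_closed_def by blast
    have sh: "s +o c \<in> C" if s: "0 - s \<in> K" and c: "c \<in> C" for s c
    proof -
      obtain x where x: "x \<in> K" "c = x +o L" using c unfolding C_def by blast
      have "x - (0 - s) \<in> K" using K s x unfolding diff_closed_def by blast
      moreover have "s +o c = (x - (0 - s)) +o L"
        unfolding x by (simp add: set_plus_rearrange2 add.commute)
      ultimately show ?thesis unfolding C_def by blast
    qed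
    have "(\<Sum>c\<in>C. f (coset_rep c)) = (\<Sum>c\<in>C. f (coset_rep (t +o c)))"
    proof (rule sum.reindex_bij_witness[of _ "\<lambda>c. t +o c" "\<lambda>c. (- t) +o c"])
      show "t +o c \<in> C" "(- t) +o c \<in> C" if "c \<in> C" for c
        using sh[OF _ that] K0 t(1) by simp_all
    qed (simp_all add: set_plus_rearrange2)
    also have "\<dots> = (\<Sum>c\<in>C. f t * f (coset_rep c))"
    proof (rule sum.cong[OF refl])
      fix c assume "c \<in> C"
      then obtain x where "c = x +o L" unfolding C_def by blast
      then show "f (coset_rep (t +o c)) = f t * f (coset_rep c)"
        by (simp add: set_plus_rearrange2 rep f(1))
    qed
    finally have "(1 - f t) * (\<Sum>c\<in>C. f (coset_rep c)) = 0"
      by (simp add: sum_distrib_left[symmetric] algebra_simps)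
    with t(2) have "(\<Sum>c\<in>C. f (coset_rep c)) = 0" by simp
    with False show ?thesis unfolding if_not_P[OF False] by simp
  qed
qed

text \<open>The factor by which a twist by \<open>s\<close> multiplies the monomial with exponent
  \<open>\<alpha>\<close>.\<close>

definition character :: "int^'n::finite \<Rightarrow> real^'n \<Rightarrow> complex" where
  "character \<alpha> s = exp (- \<i> * of_real (\<Sum>j\<in>UNIV. of_int (\<alpha> $ j) * s $ j))"

lemma character_add_left: "character (\<alpha> + \<beta>) s = character \<alpha> s * character \<beta> s"
proof -
  have "(\<Sum>j\<in>UNIV. real_of_int ((\<alpha> + \<beta>) $ j) * s $ j) =
      (\<Sum>j\<in>UNIV. of_int (\<alpha> $ j) * s $ j) + (\<Sum>j\<in>UNIV. of_int (\<beta> $ j) * s $ j)"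
    by (simp add: distrib_right sum.distrib)
  then show ?thesis
    unfolding character_def by (simp only: of_real_add distrib_left exp_add)
qed

lemma character_add_right: "character \<alpha> (s + t) = character \<alpha> s * character \<alpha> t"
proof -
  have "(\<Sum>j\<in>UNIV. real_of_int (\<alpha> $ j) * (s + t) $ j) =
      (\<Sum>j\<in>UNIV. of_int (\<alpha> $ j) * s $ j) + (\<Sum>j\<in>UNIV. of_int (\<alpha> $ j) * t $ j)"
    by (simp add: distrib_left sum.distrib)
  then show ?thesis
    unfolding character_def by (simp only: of_real_add distrib_left exp_add)
qed

lemma character_cnj: "cnj (character \<alpha> s) = character (- \<alpha>) s" "cnj (character \<alpha> s) = character \<alpha> (- s)"
  by (simp_all add: character_def exp_cnj sum_negf)

lemma character_eq_1_iff:
  "character \<alpha> s = 1 \<longleftrightarrow> (\<exists>n::int. (\<Sum>j\<in>UNIV. of_int (\<alpha> $ j) * s $ j) = 2 * pi * of_int n)"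
proof -
  define x where "x = (\<Sum>j\<in>UNIV. of_int (\<alpha> $ j) * s $ j)"
  have "exp (- \<i> * of_real x) = 1 \<longleftrightarrow> (\<exists>n::int. - x = of_int (2 * n) * pi)"
    by (simp add: exp_eq_1)
  also have "\<dots> \<longleftrightarrow> (\<exists>n::int. x = 2 * pi * of_int n)"
  proof (intro iffI; elim exE)
    fix n :: int assume "- x = of_int (2 * n) * pi"
    then have "x = 2 * pi * of_int (- n)" by (simp add: algebra_simps)
    then show "\<exists>n::int. x = 2 * pi * of_int n" by blast
  next
    fix n :: int assume "x = 2 * pi * of_int n"
    then have "- x = of_int (2 * - n) * pi" by (simp add: algebra_simps)
    then show "\<exists>n::int. - x = of_int (2 * n) * pi" by blast
  qed
  finally show ?thesis unfolding character_def x_def .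
qed


lemma character_two_pi_iff: "(\<forall>\<alpha>. character \<alpha> s = 1) \<longleftrightarrow> s \<in> two_pi_lattice"
proof
  assume all: "\<forall>\<alpha>. character \<alpha> s = 1"
  have "\<exists>n::int. s $ i = 2 * pi * of_int n" for i
  proof -
    have "(\<Sum>j\<in>UNIV. of_int (axis i (1::int) $ j) * s $ j) = (\<Sum>j\<in>UNIV. if j = i then s $ j else 0)"
      by (rule sum.cong) (auto simp: axis_def)
    then have "(\<Sum>j\<in>UNIV. of_int (axis i (1::int) $ j) * s $ j) = s $ i" by simp
    then show ?thesis using all[rule_format, of "axis i 1"] unfolding character_eq_1_iff by simp
  qed
  then obtain n where n: "\<And>i. s $ i = 2 * pi * of_int (n i)" by metis
  have "s = (2 * pi) *\<^sub>R vec_real (\<chi> i. n i)"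
    by (simp add: vec_eq_iff n)
  then show "s \<in> two_pi_lattice" unfolding two_pi_lattice_def by blast
next
  assume "s \<in> two_pi_lattice"
  then obtain k where k: "s = (2 * pi) *\<^sub>R vec_real k" unfolding two_pi_lattice_def by blast
  have "(\<Sum>j\<in>UNIV. of_int (\<alpha> $ j) * s $ j) = 2 * pi * of_int (\<Sum>j\<in>UNIV. \<alpha> $ j * k $ j)" for \<alpha>
    by (simp add: k sum_distrib_left mult_ac)
  then show "\<forall>\<alpha>. character \<alpha> s = 1" unfolding character_eq_1_iff by blast
qed

lemma diff_closed_two_pi_lattice: "diff_closed two_pi_lattice"
proof -
  have "(2 * pi) *\<^sub>R vec_real k - (2 * pi) *\<^sub>R vec_real l = (2 * pi) *\<^sub>R vec_real (k - l)"
    for k l :: "int^'a"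
    by (simp add: vec_eq_iff right_diff_distrib)
  then have "x - y \<in> two_pi_lattice" if "x \<in> two_pi_lattice" "y \<in> two_pi_lattice" for x y :: "real^'a"
    using that unfolding two_pi_lattice_def by blast
  moreover have "(0 :: real^'a) = (2 * pi) *\<^sub>R vec_real 0" by (simp add: vec_eq_iff)
  then have "(0 :: real^'a) \<in> two_pi_lattice" unfolding two_pi_lattice_def by blast
  ultimately show ?thesis unfolding diff_closed_def by blast
qed

text \<open>The lattice whose image modulo \<open>2\<pi>\<int>\<^sup>d\<close> is the group
  \<open>G\<close>.\<close>

definition dual_lattice :: "int^'d::finite^'d \<Rightarrow> (real^'d) set" where
  "dual_lattice M = (*v) (matrix_inv (transpose (map_matrix of_int M))) ` two_pi_lattice"

lemma cosets_G_eq: "cosets_G M = (\<lambda>x. x +o two_pi_lattice) ` dual_lattice M"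
  unfolding cosets_G_def dual_lattice_def by blast

lemma diff_closed_image_matrix:
  fixes B :: "'a::ring_1^'n::finite^'m::finite"
  assumes "diff_closed L"
  shows "diff_closed ((*v) B ` L)"
proof -
  have "B *v x - B *v y \<in> (*v) B ` L" if "x \<in> L" "y \<in> L" for x y
    unfolding matrix_vector_mult_diff_distrib[symmetric] using assms that
    unfolding diff_closed_def by blast
  moreover have "B *v 0 \<in> (*v) B ` L" using assms unfolding diff_closed_def by blast
  ultimately show ?thesis unfolding diff_closed_def by auto
qed

lemma diff_closed_dual_lattice: "diff_closed (dual_lattice M)"
  unfolding dual_lattice_def by (rule diff_closed_image_matrix[OF diff_closed_two_pi_lattice])

lemma matrix_inv_mult_vec:
  fixes A :: "'a::field^'n::finite^'n"
  assumes "det A \<noteq> 0"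
  shows "A *v (matrix_inv A *v x) = x" "matrix_inv A *v (A *v x) = x"
proof -
  have "\<exists>B. A ** B = mat 1 \<and> B ** A = mat 1"
    using assms invertible_det_nz[of A] unfolding invertible_def by blast
  then have "A ** matrix_inv A = mat 1 \<and> matrix_inv A ** A = mat 1"
    unfolding matrix_inv_def by (rule someI_ex)
  then show "A *v (matrix_inv A *v x) = x" "matrix_inv A *v (A *v x) = x"
    by (simp_all add: matrix_vector_mul_assoc)
qed

lemma pairing_transpose:
  fixes \<alpha> :: "int^'n::finite" and s :: "real^'n"
  shows "(\<Sum>j\<in>UNIV. of_int ((M *v \<alpha>) $ j) * s $ j)
    = (\<Sum>j\<in>UNIV. of_int (\<alpha> $ j) * (transpose (map_matrix of_int M) *v s) $ j)"
proof -
  have "(\<Sum>j\<in>UNIV. of_int ((M *v \<alpha>) $ j) * s $ j)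
      = (\<Sum>j\<in>UNIV. \<Sum>k\<in>UNIV. of_int (M $ j $ k) * of_int (\<alpha> $ k) * s $ j)"
    by (simp add: matrix_vector_mult_def sum_distrib_right)
  also have "\<dots> = (\<Sum>k\<in>UNIV. \<Sum>j\<in>UNIV. of_int (M $ j $ k) * of_int (\<alpha> $ k) * s $ j)"
    by (rule sum.swap)
  also have "\<dots> = (\<Sum>k\<in>UNIV. of_int (\<alpha> $ k) * (transpose (map_matrix of_int M) *v s) $ k)"
    by (simp add: matrix_vector_mult_def transpose_def sum_distrib_left mult_ac)
  finally show ?thesis .
qed

lemma character_mult_matrix:
  fixes M :: "int^'n::finite^'n"
  shows "character (M *v \<alpha>) s = character \<alpha> (transpose (map_matrix of_int M) *v s)"
  by (simp only: character_def pairing_transpose)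

text \<open>For the converse direction, test \<open>\<alpha>\<close> against the basis vectors of
  the dual lattice: they read off the coordinates of \<open>M\<^sup>-\<^sup>1 \<alpha>\<close>,
  which are therefore integers.\<close>

lemma character_dual_iff:
  fixes M :: "int^'n::finite^'n"
  assumes "det M \<noteq> 0"
  shows "(\<forall>s\<in>dual_lattice M. character \<alpha> s = 1) \<longleftrightarrow> \<alpha> \<in> range ((*v) M)"
proof -
  let ?A = "map_matrix of_int M :: real^'n^'n"
  have dA: "det ?A \<noteq> 0" "det (transpose ?A) \<noteq> 0" using assms by (simp_all add: det_map_of_int)
  note inv = matrix_inv_mult_vec[OF dA(1)] and invT = matrix_inv_mult_vec[OF dA(2)]
  show ?thesis
  proof
    assume "\<alpha> \<in> range ((*v) M)"
    then obtain \<beta> where \<beta>: "\<alpha> = M *v \<beta>" by blast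
    show "\<forall>s\<in>dual_lattice M. character \<alpha> s = 1"
      unfolding \<beta> character_mult_matrix dual_lattice_def ball_simps invT
      using character_two_pi_iff by blast
  next
    assume all: "\<forall>s\<in>dual_lattice M. character \<alpha> s = 1"
    define y where "y = matrix_inv ?A *v vec_real \<alpha>"
    have y: "vec_real \<alpha> = ?A *v y" unfolding y_def inv(1) ..
    have "\<exists>n::int. y $ i = of_int n" for i
    proof -
      define e where "e = (2 * pi) *\<^sub>R vec_real (axis i 1)"
      have "e \<in> two_pi_lattice" unfolding e_def two_pi_lattice_def by blast
      then have "character \<alpha> (matrix_inv (transpose ?A) *v e) = 1"
        using all unfolding dual_lattice_def by blast
      then obtain n :: int where n:
        "(\<Sum>j\<in>UNIV. of_int (\<alpha> $ j) * (matrix_inv (transpose ?A) *v e) $ j) = 2 * pi * of_int n"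
        unfolding character_eq_1_iff by blast
      have "(\<Sum>j\<in>UNIV. of_int (\<alpha> $ j) * (matrix_inv (transpose ?A) *v e) $ j)
          = (?A *v y) \<bullet> (matrix_inv (transpose ?A) *v e)"
        unfolding y[symmetric] by (simp add: inner_vec_def)
      also have "\<dots> = y \<bullet> (transpose ?A *v (matrix_inv (transpose ?A) *v e))"
        by (metis dot_lmul_matrix transpose_transpose vector_transpose_matrix)
      also have "\<dots> = y \<bullet> e" unfolding invT ..
      also have "\<dots> = (\<Sum>j\<in>UNIV. if j = i then 2 * pi * y $ j else 0)"
        unfolding inner_vec_def by (rule sum.cong) (auto simp: e_def axis_def)
      finally have "2 * pi * y $ i = 2 * pi * of_int n" using n by simp
      then show ?thesis by (intro exI[of _ n]) simp
    qed
    then obtain n where n: "\<And>i. y $ i = of_int (n i)" by metis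
    have "y = vec_real (\<chi> i. n i)" by (simp add: vec_eq_iff n)
    then have "vec_real \<alpha> = vec_real (M *v (\<chi> i. n i))"
      unfolding y by (simp only: map_matrix_of_int_mult)
    then have "\<alpha> = M *v (\<chi> i. n i)" by (simp add: vec_eq_iff)
    then show "\<alpha> \<in> range ((*v) M)" by (rule range_eqI)
  qed
qed

text \<open>Multiplication by \<open>2\<pi> M\<^sup>-\<^sup>T\<close> identifies
  \<open>\<int>\<^sup>n\<close> modulo \<open>M\<^sup>T \<int>\<^sup>n\<close> with
  \<open>G\<close>, and the transpose has the same determinant.\<close>

lemma card_cosets_G:
  fixes M :: "int^'n::finite^'n"
  assumes "det M \<noteq> 0"
  shows "finite (cosets_G M)" and "of_nat (card (cosets_G M)) = \<bar>det M\<bar>"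
proof -
  let ?AT = "transpose (map_matrix of_int M) :: real^'n^'n"
  \<comment> \<open>A coset of \<open>\<alpha>\<close> modulo \<open>M\<^sup>T \<int>\<^sup>n\<close> corresponds to the coset of \<open>\<theta> \<alpha>\<close>.\<close>
  define \<theta> where "\<theta> \<alpha> = matrix_inv ?AT *v ((2 * pi) *\<^sub>R vec_real \<alpha>)" for \<alpha> :: "int^'n"
  define f where "f \<alpha> = \<theta> \<alpha> +o two_pi_lattice" for \<alpha>
  define g where "g \<alpha> = \<alpha> +o range ((*v) (transpose M))" for \<alpha>
  have T: "?AT = map_matrix of_int (transpose M)" by (simp add: vec_eq_iff transpose_def)
  have d: "det ?AT \<noteq> 0" using assms by (simp add: det_map_of_int)
  note inv = matrix_inv_mult_vec[OF d]
  have \<theta>_diff: "\<theta> \<alpha> - \<theta> \<beta> = \<theta> (\<alpha> - \<beta>)" for \<alpha> \<beta>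
  proof -
    have "(2 * pi) *\<^sub>R vec_real \<alpha> - (2 * pi) *\<^sub>R vec_real \<beta> = (2 * pi) *\<^sub>R vec_real (\<alpha> - \<beta>)"
      by (simp add: vec_eq_iff algebra_simps)
    then show ?thesis unfolding \<theta>_def by (simp only: matrix_vector_mult_diff_distrib[symmetric])
  qed
  have \<theta>_mem: "\<theta> \<gamma> \<in> two_pi_lattice \<longleftrightarrow> \<gamma> \<in> range ((*v) (transpose M))" for \<gamma>
  proof -
    have "\<theta> \<gamma> = (2 * pi) *\<^sub>R vec_real k \<longleftrightarrow> \<gamma> = transpose M *v k" for k
    proof -
      have "\<theta> \<gamma> = (2 * pi) *\<^sub>R vec_real k \<longleftrightarrow> (2 * pi) *\<^sub>R vec_real \<gamma> = ?AT *v ((2 * pi) *\<^sub>R vec_real k)"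
        unfolding \<theta>_def using inv by metis
      also have "\<dots> \<longleftrightarrow> (2 * pi) *\<^sub>R vec_real \<gamma> = (2 * pi) *\<^sub>R vec_real (transpose M *v k)"
        unfolding matrix_vector_mult_scaleR T map_matrix_of_int_mult ..
      also have "\<dots> \<longleftrightarrow> \<gamma> = transpose M *v k"
        by (simp add: vec_eq_iff)
      finally show ?thesis .
    qed
    then show ?thesis unfolding two_pi_lattice_def image_iff by blast
  qed
  have fg: "f \<alpha> = f \<beta> \<longleftrightarrow> g \<alpha> = g \<beta>" for \<alpha> \<beta>
    unfolding f_def g_def coset_eq_iff[OF diff_closed_two_pi_lattice]
      coset_eq_iff[OF diff_closed_range_matrix] \<theta>_diff \<theta>_mem ..
  have F: "cosets_G M = range f"
    unfolding cosets_G_eq dual_lattice_def two_pi_lattice_def f_def \<theta>_def by (simp only: image_image)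
  have G: "cosets_G' (transpose M) = range g"
    unfolding cosets_G'_eq g_def ..
  have "bij_betw (\<lambda>c. f (inv g c)) (range g) (range f)"
  proof (rule bij_betwI')
    show "f (inv g c) = f (inv g c') \<longleftrightarrow> c = c'" if "c \<in> range g" "c' \<in> range g" for c c'
      using that unfolding fg by (simp add: f_inv_into_f)
    show "\<exists>c\<in>range g. x = f (inv g c)" if x: "x \<in> range f" for x
    proof -
      obtain \<alpha> where \<alpha>: "x = f \<alpha>" using x by blast
      have "x = f (inv g (g \<alpha>))" unfolding \<alpha> fg by (simp add: f_inv_into_f)
      then show ?thesis by blast
    qed
  qed auto
  note bij = this[folded F G]
  have d': "det (transpose M) \<noteq> 0" using assms by simp
  show "finite (cosets_G M)"
    using bij_betw_finite[OF bij] card_cosets_G'(1)[OF d'] by blast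
  show "of_nat (card (cosets_G M)) = \<bar>det M\<bar>"
    using bij_betw_same_card[OF bij] card_cosets_G'(2)[OF d'] by simp
qed

lemma character_orthogonality_G:
  fixes M :: "int^'n::finite^'n"
  assumes "det M \<noteq> 0"
  shows "(\<Sum>c\<in>cosets_G M. cnj (character \<alpha> (coset_rep c)) * character \<beta> (coset_rep c))
    = (if \<alpha> +o range ((*v) M) = \<beta> +o range ((*v) M) then of_int \<bar>det M\<bar> else 0)"
proof -
  have "(\<Sum>c\<in>cosets_G M. cnj (character \<alpha> (coset_rep c)) * character \<beta> (coset_rep c))
      = (\<Sum>c\<in>cosets_G M. character (\<beta> - \<alpha>) (coset_rep c))"
    unfolding character_cnj(1) character_add_left[symmetric] by simp
  also have "\<dots> = (if \<forall>s\<in>dual_lattice M. character (\<beta> - \<alpha>) s = 1 then of_nat (card (cosets_G M)) else 0)"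
    unfolding cosets_G_eq
    by (rule sum_character_cosets[OF diff_closed_two_pi_lattice diff_closed_dual_lattice character_add_right])
       (use character_two_pi_iff in blast)
  also have "(\<forall>s\<in>dual_lattice M. character (\<beta> - \<alpha>) s = 1) \<longleftrightarrow> \<alpha> +o range ((*v) M) = \<beta> +o range ((*v) M)"
    unfolding character_dual_iff[OF assms] coset_eq_iff[OF diff_closed_range_matrix, symmetric] by blast
  also have "(of_nat (card (cosets_G M)) :: complex) = of_int \<bar>det M\<bar>"
    unfolding card_cosets_G(2)[OF assms, symmetric] by simp
  finally show ?thesis .
qed

lemma character_orthogonality_G':
  fixes M :: "int^'n::finite^'n"
  assumes "det M \<noteq> 0" "s \<in> dual_lattice M" "t \<in> dual_lattice M"
  shows "(\<Sum>c\<in>cosets_G' M. cnj (character (coset_rep c) s) * character (coset_rep c) t)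
    = (if s +o two_pi_lattice = t +o two_pi_lattice then of_int \<bar>det M\<bar> else 0)"
proof -
  have "t - s \<in> dual_lattice M"
    using diff_closed_dual_lattice assms(2,3) unfolding diff_closed_def by blast
  then have trivial: "character \<alpha> (t - s) = 1" if "\<alpha> \<in> range ((*v) M)" for \<alpha>
    using that character_dual_iff[OF assms(1)] by blast
  have UNIV: "diff_closed (UNIV :: (int^'n) set)" by (simp add: diff_closed_def)
  have "(\<Sum>c\<in>cosets_G' M. cnj (character (coset_rep c) s) * character (coset_rep c) t)
      = (\<Sum>c\<in>cosets_G' M. character (coset_rep c) (t - s))"
    unfolding character_cnj(2) character_add_right[symmetric] by simp
  also have "\<dots> = (if \<forall>\<alpha>\<in>UNIV. character \<alpha> (t - s) = 1 then of_nat (card (cosets_G' M)) else 0)"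
    unfolding cosets_G'_eq
    by (rule sum_character_cosets[OF diff_closed_range_matrix UNIV character_add_left trivial])
  also have "(\<forall>\<alpha>\<in>UNIV. character \<alpha> (t - s) = 1) \<longleftrightarrow> s +o two_pi_lattice = t +o two_pi_lattice"
    using character_two_pi_iff[of "t - s"]
    unfolding coset_eq_iff[OF diff_closed_two_pi_lattice, symmetric] by auto
  also have "(of_nat (card (cosets_G' M)) :: complex) = of_int \<bar>det M\<bar>"
    unfolding card_cosets_G'(2)[OF assms(1), symmetric] by simp
  finally show ?thesis .
qed

section \<open>The involution on Laurent polynomials\<close>

text \<open>Properties that are additive need only be checked on monomials.\<close>

lemma poly_mapping_induct_add [case_names zero single add]:
  fixes p :: "'a \<Rightarrow>\<^sub>0 'b::comm_monoid_add"
  assumes "P 0" "\<And>k c. P (Poly_Mapping.single k c)" "\<And>f g. P f \<Longrightarrow> P g \<Longrightarrow> P (f + g)"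
  shows "P p"
proof -
  have "P (\<Sum>k\<in>F. Poly_Mapping.single k (Poly_Mapping.lookup p k))" if "finite F" for F
    using that by (induction F) (simp_all add: assms)
  from this[OF finite_keys[of p]] show ?thesis by (simp only: poly_mapping_sum_singles)
qed

abbreviation const :: "complex \<Rightarrow> 'a::zero \<Rightarrow>\<^sub>0 complex" where
  "const c \<equiv> Poly_Mapping.single 0 c"

lemma const_mult: "const a * const b = (const (a * b) :: 'a::monoid_add \<Rightarrow>\<^sub>0 complex)"
  by (simp add: mult_single)

lemma const_sum: "const (\<Sum>i\<in>S. f i) = (\<Sum>i\<in>S. const (f i))"
  by (rule poly_mapping_eqI) (simp add: lookup_sum lookup_single when_def)

lemma const_1: "const 1 = 1"
  by (simp add: single_one)

lemma lookup_const_times: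
  fixes p :: "'a::ab_group_add \<Rightarrow>\<^sub>0 complex"
  shows "Poly_Mapping.lookup (const c * p) b = c * Poly_Mapping.lookup p b"
  by (induction p rule: poly_mapping_induct_add)
     (simp_all add: mult_single lookup_single when_def distrib_left lookup_add)

lemma star_add: "star (p + q) = star p + star q"
  and star_diff: "star (p - q) = star p - star q"
  and star_zero: "star 0 = 0"
  and star_star: "star (star p) = p"
  and star_sum: "star (\<Sum>i\<in>S. f i) = (\<Sum>i\<in>S. star (f i))"
  by (rule poly_mapping_eqI, simp add: lookup_star lookup_add lookup_minus lookup_sum)+

lemma star_single: "star (Poly_Mapping.single \<alpha> c) = Poly_Mapping.single (- \<alpha>) (cnj c)"
proof (rule poly_mapping_eqI)
  have "\<alpha> = - k \<longleftrightarrow> - \<alpha> = k" for k by auto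
  then show "Poly_Mapping.lookup (star (Poly_Mapping.single \<alpha> c)) k =
      Poly_Mapping.lookup (Poly_Mapping.single (- \<alpha>) (cnj c)) k" for k
    by (simp add: lookup_star lookup_single when_def)
qed

lemma star_mult: "star (p * q) = star p * star q"
proof (induction p rule: poly_mapping_induct_add)
  case (single k c)
  show ?case
  proof (induction q rule: poly_mapping_induct_add)
    case (single l d)
    show ?case by (simp add: mult_single star_single)
  qed (simp_all add: star_zero star_add distrib_left)
qed (simp_all add: star_zero star_add distrib_right)

lemma star_const: "star (const c) = const (cnj c)"
  by (simp add: star_single)

lemma star_one: "star 1 = 1"
  unfolding const_1[symmetric] star_const by simp

section \<open>Homogeneous components and multiplication\<close>

text \<open>The component supported on the exponents in \<open>S\<close>. The exponent type is
  arbitrary, since components are needed for Laurent polynomials and in the tensor square.\<close>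

definition part :: "'a set \<Rightarrow> ('a \<Rightarrow>\<^sub>0 complex) \<Rightarrow> 'a \<Rightarrow>\<^sub>0 complex" where
  "part S p = (\<Sum>k\<in>Poly_Mapping.keys p \<inter> S. Poly_Mapping.single k (Poly_Mapping.lookup p k))"

lemma lookup_part:
  "Poly_Mapping.lookup (part S p) k = (if k \<in> S then Poly_Mapping.lookup p k else 0)"
  unfolding part_def by (subst lookup_sum_single) (auto simp: in_keys_iff)

lemma part_add: "part S (p + q) = part S p + part S q"
  and part_diff: "part S (p - q) = part S p - part S q"
  and part_sum: "part S (\<Sum>i\<in>I. f i) = (\<Sum>i\<in>I. part S (f i))"
  by (rule poly_mapping_eqI, simp add: lookup_part lookup_add lookup_minus lookup_sum)+

lemma keys_part: "Poly_Mapping.keys (part S p) = Poly_Mapping.keys p \<inter> S"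
  by (auto simp: in_keys_iff lookup_part split: if_splits)

lemma part_eq_self: "Poly_Mapping.keys p \<subseteq> S \<Longrightarrow> part S p = p"
  by (rule poly_mapping_eqI) (auto simp: lookup_part in_keys_iff)

lemma part_eq_zero: "Poly_Mapping.keys p \<inter> S = {} \<Longrightarrow> part S p = 0"
  by (rule poly_mapping_eqI) (auto simp: lookup_part in_keys_iff)

lemma part_const_times:
  fixes p :: "'a::ab_group_add \<Rightarrow>\<^sub>0 complex"
  shows "part S (const c * p) = const c * part S p"
  by (rule poly_mapping_eqI) (simp add: lookup_part lookup_const_times)

lemma part_star: "part (uminus ` S) (star p) = star (part S p)"
proof (rule poly_mapping_eqI)
  have "k \<in> uminus ` S \<longleftrightarrow> - k \<in> S" for k by (auto simp: image_iff intro: bexI[of _ "- k"])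
  then show "Poly_Mapping.lookup (part (uminus ` S) (star p)) k = Poly_Mapping.lookup (star (part S p)) k" for k
    by (simp add: lookup_part lookup_star)
qed

text \<open>A factor whose monomials all translate \<open>S\<close> onto \<open>T\<close> can be
  pulled out of a component.\<close>

lemma part_mult_shift:
  fixes a b :: "'a::ab_group_add \<Rightarrow>\<^sub>0 complex"
  assumes "\<And>k. k \<in> Poly_Mapping.keys a \<Longrightarrow> (\<lambda>l. k + l) -` T = S"
  shows "part T (a * b) = a * part S b"
proof -
  have b: "b = part S b + part (- S) b"
    by (rule poly_mapping_eqI) (simp add: lookup_part lookup_add)
  have iff: "k + l \<in> T \<longleftrightarrow> l \<in> S" if "k \<in> Poly_Mapping.keys a" for k l
    using assms[OF that] by blast
  have "Poly_Mapping.keys (a * part S b) \<subseteq> T"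
    using keys_mult[of a "part S b"] iff unfolding keys_part by blast
  moreover have "Poly_Mapping.keys (a * part (- S) b) \<inter> T = {}"
    using keys_mult[of a "part (- S) b"] iff unfolding keys_part by blast
  ultimately have "part T (a * part S b + a * part (- S) b) = a * part S b"
    unfolding part_add by (simp add: part_eq_self part_eq_zero)
  then show ?thesis unfolding distrib_left[symmetric] b[symmetric] .
qed

lemma mu_superset:
  assumes "finite S" "Poly_Mapping.keys f \<subseteq> S"
  shows "mu f = (\<Sum>(\<alpha>, \<beta>)\<in>S. Poly_Mapping.single (\<alpha> + \<beta>) (Poly_Mapping.lookup f (\<alpha>, \<beta>)))"
  unfolding mu_def using assms
  by (intro sum.mono_neutral_left) (auto simp: in_keys_iff)

lemma mu_add: "mu (f + g) = mu f + mu g"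
proof -
  let ?S = "Poly_Mapping.keys f \<union> Poly_Mapping.keys g"
  have "Poly_Mapping.keys (f + g) \<subseteq> ?S" by (rule keys_add)
  then show ?thesis
    using mu_superset[of ?S f] mu_superset[of ?S g] mu_superset[of ?S "f + g"]
    by (simp add: sum.distrib[symmetric] lookup_add single_add case_prod_unfold)
qed

lemma mu_zero: "mu 0 = 0"
  by (simp add: mu_def)

lemma mu_diff: "mu (f - g) = mu f - mu g"
  using mu_add[of "f - g" g] by (simp add: algebra_simps)

lemma mu_sum: "mu (\<Sum>i\<in>S. f i) = (\<Sum>i\<in>S. mu (f i))"
  by (induction S rule: infinite_finite_induct) (simp_all add: mu_zero mu_add)

lemma part_tensor: "part (S \<times> T) (tensor p q) = tensor (part S p) (part T q)"
  by (rule poly_mapping_eqI) (auto simp: lookup_part lookup_tensor split: if_splits)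

section \<open>The grading by exponent cosets and the ideal J\<close>

lemma cosets_G'_cover: "\<exists>\<xi>\<in>cosets_G' M. \<alpha> \<in> \<xi>"
proof -
  have "\<alpha> \<in> \<alpha> +o range ((*v) M)"
    using diff_closed_range_matrix[of M] unfolding mem_coset_iff diff_closed_def by simp
  then show ?thesis unfolding cosets_G'_eq by blast
qed

lemma cosets_G'_mem:
  assumes "\<xi> \<in> cosets_G' M" "\<alpha> \<in> \<xi>"
  shows "\<xi> = \<alpha> +o range ((*v) M)"
proof -
  obtain \<beta> where \<beta>: "\<xi> = \<beta> +o range ((*v) M)" using assms(1) unfolding cosets_G'_eq by blast
  have "\<alpha> +o range ((*v) M) = \<beta> +o range ((*v) M)"
    unfolding coset_eq_iff[OF diff_closed_range_matrix] using assms(2) unfolding \<beta> mem_coset_iff .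
  then show ?thesis using \<beta> by simp
qed

lemma cosets_G'_disjoint:
  assumes "\<xi> \<in> cosets_G' M" "\<eta> \<in> cosets_G' M" "\<alpha> \<in> \<xi>" "\<alpha> \<in> \<eta>"
  shows "\<xi> = \<eta>"
  using cosets_G'_mem assms by metis

lemma coset_rep_mem:
  assumes "\<xi> \<in> cosets_G' M"
  shows "coset_rep \<xi> \<in> \<xi>"
  using assms coset_rep_diff[OF diff_closed_range_matrix[of M]]
  unfolding cosets_G'_eq by (auto simp: mem_coset_iff)

lemma uminus_cosets_G':
  assumes "\<xi> \<in> cosets_G' M"
  shows "uminus ` \<xi> \<in> cosets_G' M"
proof -
  obtain \<beta> where \<beta>: "\<xi> = \<beta> +o range ((*v) M)" using assms unfolding cosets_G'_eq by blast
  have neg: "- r \<in> range ((*v) M)" if "r \<in> range ((*v) M)" for r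
    using diff_closed_range_matrix[of M] that unfolding diff_closed_def by (metis diff_0)
  have "x \<in> uminus ` \<xi> \<longleftrightarrow> x \<in> (- \<beta>) +o range ((*v) M)" for x
  proof -
    have "x \<in> uminus ` \<xi> \<longleftrightarrow> - x \<in> \<xi>"
      by (auto simp: image_iff intro: bexI[of _ "- x"])
    also have "\<dots> \<longleftrightarrow> - (x + \<beta>) \<in> range ((*v) M)"
      unfolding \<beta> mem_coset_iff by simp
    also have "\<dots> \<longleftrightarrow> x - (- \<beta>) \<in> range ((*v) M)"
      using neg[of "- (x + \<beta>)"] neg[of "x + \<beta>"] by (simp only: minus_minus diff_minus_eq_add) blast
    finally show ?thesis unfolding mem_coset_iff .
  qed
  then have "uminus ` \<xi> = (- \<beta>) +o range ((*v) M)" by blast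
  then show ?thesis unfolding cosets_G'_eq by blast
qed

lemma sum_part_cosets:
  fixes f :: "(int^'n::finite) \<Rightarrow>\<^sub>0 complex"
  assumes "finite (cosets_G' M)"
  shows "(\<Sum>\<xi>\<in>cosets_G' M. part \<xi> f) = f"
proof (rule poly_mapping_eqI)
  fix k
  obtain \<xi> where \<xi>: "\<xi> \<in> cosets_G' M" "k \<in> \<xi>" using cosets_G'_cover by blast
  have "(\<Sum>\<eta>\<in>cosets_G' M. Poly_Mapping.lookup (part \<eta> f) k)
      = (\<Sum>\<eta>\<in>cosets_G' M. if \<eta> = \<xi> then Poly_Mapping.lookup f k else 0)"
  proof (rule sum.cong[OF refl])
    fix \<eta> assume "\<eta> \<in> cosets_G' M"
    then have "k \<in> \<eta> \<longleftrightarrow> \<eta> = \<xi>" using \<xi> cosets_G'_disjoint by blast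
    then show "Poly_Mapping.lookup (part \<eta> f) k = (if \<eta> = \<xi> then Poly_Mapping.lookup f k else 0)"
      by (simp add: lookup_part)
  qed
  then show "Poly_Mapping.lookup (\<Sum>\<xi>\<in>cosets_G' M. part \<xi> f) k = Poly_Mapping.lookup f k"
    unfolding lookup_sum using assms \<xi>(1) by simp
qed

lemma sum_part_cosets2:
  fixes f :: "'n::finite laurent2"
  assumes "finite (cosets_G' M)"
  shows "(\<Sum>\<xi>\<in>cosets_G' M. \<Sum>\<eta>\<in>cosets_G' M. part (\<xi> \<times> \<eta>) f) = f"
proof (rule poly_mapping_eqI)
  fix k :: "(int^'n) \<times> (int^'n)"
  obtain \<xi> where \<xi>: "\<xi> \<in> cosets_G' M" "fst k \<in> \<xi>" using cosets_G'_cover by blast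
  obtain \<eta> where \<eta>: "\<eta> \<in> cosets_G' M" "snd k \<in> \<eta>" using cosets_G'_cover by blast
  have "Poly_Mapping.lookup (part (\<xi>' \<times> \<eta>') f) k =
      (if \<xi>' = \<xi> then if \<eta>' = \<eta> then Poly_Mapping.lookup f k else 0 else 0)"
    if "\<xi>' \<in> cosets_G' M" "\<eta>' \<in> cosets_G' M" for \<xi>' \<eta>'
  proof -
    have "fst k \<in> \<xi>' \<longleftrightarrow> \<xi>' = \<xi>" "snd k \<in> \<eta>' \<longleftrightarrow> \<eta>' = \<eta>"
      using that \<xi> \<eta> cosets_G'_disjoint by blast+
    then show ?thesis by (simp add: lookup_part mem_Times_iff)
  qed
  then have "(\<Sum>\<xi>\<in>cosets_G' M. \<Sum>\<eta>\<in>cosets_G' M. Poly_Mapping.lookup (part (\<xi> \<times> \<eta>) f) k)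
      = (\<Sum>\<xi>'\<in>cosets_G' M. \<Sum>\<eta>'\<in>cosets_G' M.
          if \<xi>' = \<xi> then if \<eta>' = \<eta> then Poly_Mapping.lookup f k else 0 else 0)"
    by (intro sum.cong refl)
  also have "\<dots> = Poly_Mapping.lookup f k"
  proof -
    have "(\<Sum>\<eta>'\<in>cosets_G' M. if \<xi>' = \<xi> then if \<eta>' = \<eta> then Poly_Mapping.lookup f k else 0 else 0)
        = (if \<xi>' = \<xi> then Poly_Mapping.lookup f k else 0)" for \<xi>'
      using assms \<eta>(1) by (cases "\<xi>' = \<xi>") simp_all
    then show ?thesis using assms \<xi>(1) by simp
  qed
  finally show "Poly_Mapping.lookup (\<Sum>\<xi>\<in>cosets_G' M. \<Sum>\<eta>\<in>cosets_G' M. part (\<xi> \<times> \<eta>) f) k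
      = Poly_Mapping.lookup f k"
    unfolding lookup_sum .
qed

lemma part_bigraded:
  assumes "\<xi> \<in> cosets_G' M" "\<eta> \<in> cosets_G' M" "\<xi>' \<in> cosets_G' M" "\<eta>' \<in> cosets_G' M"
    and "f \<in> bigraded \<xi>' \<eta>'"
  shows "part (\<xi> \<times> \<eta>) f = (if \<xi> = \<xi>' \<and> \<eta> = \<eta>' then f else 0)"
proof -
  have keys: "Poly_Mapping.keys f \<subseteq> \<xi>' \<times> \<eta>'" using assms(5) by (simp add: bigraded_def monomial_span_eq)
  show ?thesis
  proof (cases "\<xi> = \<xi>' \<and> \<eta> = \<eta>'")
    case False
    then have "(\<xi>' \<times> \<eta>') \<inter> (\<xi> \<times> \<eta>) = {}"
      using cosets_G'_disjoint assms(1-4) by blast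
    then show ?thesis using False keys by (auto intro: part_eq_zero)
  qed (use keys in \<open>simp add: part_eq_self\<close>)
qed

text \<open>The degrees are disjoint, so the summands in the definition of \<open>J\<close> can
  only be the bihomogeneous components of \<open>f\<close>.\<close>

lemma J_ideal_iff:
  assumes fin: "finite (cosets_G' M)"
  shows "f \<in> J_ideal M \<longleftrightarrow> (\<forall>\<xi>\<in>cosets_G' M. \<forall>\<eta>\<in>cosets_G' M. mu (part (\<xi> \<times> \<eta>) f) = 0)"
proof
  assume "f \<in> J_ideal M"
  then obtain F where f: "f = (\<Sum>\<xi>\<in>cosets_G' M. \<Sum>\<eta>\<in>cosets_G' M. F \<xi> \<eta>)"
    and F: "\<forall>\<xi>\<in>cosets_G' M. \<forall>\<eta>\<in>cosets_G' M. F \<xi> \<eta> \<in> I_ideal \<inter> bigraded \<xi> \<eta>"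
    unfolding J_ideal_def by blast
  show "\<forall>\<xi>\<in>cosets_G' M. \<forall>\<eta>\<in>cosets_G' M. mu (part (\<xi> \<times> \<eta>) f) = 0"
  proof (intro ballI)
    fix \<xi> \<eta> assume \<xi>\<eta>: "\<xi> \<in> cosets_G' M" "\<eta> \<in> cosets_G' M"
    have "mu (part (\<xi> \<times> \<eta>) (F \<xi>' \<eta>')) = 0" if "\<xi>' \<in> cosets_G' M" "\<eta>' \<in> cosets_G' M" for \<xi>' \<eta>'
      using F that part_bigraded[OF \<xi>\<eta> that, of "F \<xi>' \<eta>'"] by (auto simp: mu_zero I_ideal_def)
    then show "mu (part (\<xi> \<times> \<eta>) f) = 0" unfolding f part_sum mu_sum by simp
  qed
next
  assume zero: "\<forall>\<xi>\<in>cosets_G' M. \<forall>\<eta>\<in>cosets_G' M. mu (part (\<xi> \<times> \<eta>) f) = 0"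
  have "\<forall>\<xi>\<in>cosets_G' M. \<forall>\<eta>\<in>cosets_G' M. part (\<xi> \<times> \<eta>) f \<in> I_ideal \<inter> bigraded \<xi> \<eta>"
    using zero by (simp add: I_ideal_def bigraded_def monomial_span_eq keys_part)
  moreover have "f = (\<Sum>\<xi>\<in>cosets_G' M. \<Sum>\<eta>\<in>cosets_G' M. part (\<xi> \<times> \<eta>) f)"
    by (rule sum_part_cosets2[OF fin, symmetric])
  ultimately show "f \<in> J_ideal M"
    unfolding J_ideal_def mem_Collect_eq by (intro exI[of _ "\<lambda>\<xi> \<eta>. part (\<xi> \<times> \<eta>) f"] conjI)
qed

section \<open>The Fourier transform between components and twists\<close>

text \<open>The condition through which all the equivalences pass: it is the matrix identity for
  twists in terms of homogeneous components.\<close>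

definition polyphase_sos :: "int^'d::finite^'d \<Rightarrow> 'd laurent \<Rightarrow> bool" where
  "polyphase_sos M p \<longleftrightarrow> (\<exists>(N::nat) q. \<forall>\<xi>\<in>cosets_G' M. \<forall>\<eta>\<in>cosets_G' M.
     (if \<xi> = \<eta> then const (1 / of_int \<bar>det M\<bar>) else 0) - star (part \<xi> p) * part \<eta> p =
     (\<Sum>j<N. star (part \<xi> (q j)) * part \<eta> (q j)))"

text \<open>Representatives of the cosets in \<open>G\<close> therefore lie in the dual lattice
  again.\<close>

lemma two_pi_lattice_subset_dual:
  fixes M :: "int^'n::finite^'n"
  assumes "det M \<noteq> 0"
  shows "two_pi_lattice \<subseteq> dual_lattice M"
proof
  fix x :: "real^'n" assume "x \<in> two_pi_lattice"
  then obtain k where x: "x = (2 * pi) *\<^sub>R vec_real k" unfolding two_pi_lattice_def by blast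
  let ?AT = "transpose (map_matrix of_int M) :: real^'n^'n"
  have T: "?AT = map_matrix of_int (transpose M)" by (simp add: vec_eq_iff transpose_def)
  have "det ?AT \<noteq> 0" using assms by (simp add: det_map_of_int)
  then have "x = matrix_inv ?AT *v (?AT *v x)" by (rule matrix_inv_mult_vec(2)[symmetric])
  moreover have "?AT *v x = (2 * pi) *\<^sub>R vec_real (transpose M *v k)"
    unfolding x matrix_vector_mult_scaleR T map_matrix_of_int_mult ..
  ultimately show "x \<in> dual_lattice M"
    unfolding dual_lattice_def two_pi_lattice_def by blast
qed

lemma coset_rep_dual_lattice:
  assumes "det M \<noteq> 0" "\<sigma> \<in> cosets_G M"
  shows "coset_rep \<sigma> \<in> dual_lattice M" "\<sigma> = coset_rep \<sigma> +o two_pi_lattice"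
proof -
  obtain x where x: "x \<in> dual_lattice M" "\<sigma> = x +o two_pi_lattice"
    using assms(2) unfolding cosets_G_eq by blast
  have "0 - x \<in> dual_lattice M" "coset_rep \<sigma> - x \<in> dual_lattice M"
    using x diff_closed_dual_lattice[of M] coset_rep_diff[OF diff_closed_two_pi_lattice, of x]
      two_pi_lattice_subset_dual[OF assms(1)] unfolding diff_closed_def by blast+
  then have "(coset_rep \<sigma> - x) - (0 - x) \<in> dual_lattice M"
    using diff_closed_dual_lattice[of M] unfolding diff_closed_def by blast
  then show "coset_rep \<sigma> \<in> dual_lattice M" by simp
  show "\<sigma> = coset_rep \<sigma> +o two_pi_lattice"
    unfolding x(2) coset_rep_coset[OF diff_closed_two_pi_lattice] ..
qed

abbreviation dft :: "(int^'d::finite) set \<Rightarrow> (real^'d) set \<Rightarrow> complex" where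
  "dft \<xi> \<sigma> \<equiv> character (coset_rep \<xi>) (coset_rep \<sigma>)"

text \<open>On a monomial of degree \<open>\<xi>\<close> the twist acts by a scalar that depends
  only on \<open>\<xi>\<close>, since characters are trivial on \<open>M
  \<int>\<^sup>d\<close>.\<close>

lemma twist_coset_eq_sum_parts:
  assumes "det M \<noteq> 0" "\<sigma> \<in> cosets_G M"
  shows "twist_coset p \<sigma> = (\<Sum>\<xi>\<in>cosets_G' M. const (dft \<xi> \<sigma>) * part \<xi> p)"
proof (rule poly_mapping_eqI)
  fix \<alpha>
  have fin: "finite (cosets_G' M)" using card_cosets_G'(1)[OF assms(1)] .
  have eq: "character (coset_rep \<xi>) (coset_rep \<sigma>) = character \<alpha> (coset_rep \<sigma>)"
    if "\<xi> \<in> cosets_G' M" "\<alpha> \<in> \<xi>" for \<xi>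
  proof -
    have "\<xi> = \<alpha> +o range ((*v) M)" using that by (rule cosets_G'_mem)
    then have "coset_rep \<xi> - \<alpha> \<in> range ((*v) M)"
      using coset_rep_diff[OF diff_closed_range_matrix[of M], of \<alpha>] by simp
    then have "character (coset_rep \<xi> - \<alpha>) (coset_rep \<sigma>) = 1"
      using character_dual_iff[OF assms(1)] coset_rep_dual_lattice(1)[OF assms] by blast
    then show ?thesis
      using character_add_left[of "coset_rep \<xi> - \<alpha>" \<alpha> "coset_rep \<sigma>"] by simp
  qed
  have "Poly_Mapping.lookup (\<Sum>\<xi>\<in>cosets_G' M. const (dft \<xi> \<sigma>) * part \<xi> p) \<alpha>
      = (\<Sum>\<xi>\<in>cosets_G' M. character \<alpha> (coset_rep \<sigma>) * Poly_Mapping.lookup (part \<xi> p) \<alpha>)"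
    unfolding lookup_sum lookup_const_times
    by (rule sum.cong[OF refl]) (simp add: lookup_part eq)
  also have "\<dots> = character \<alpha> (coset_rep \<sigma>) * Poly_Mapping.lookup (\<Sum>\<xi>\<in>cosets_G' M. part \<xi> p) \<alpha>"
    by (simp add: lookup_sum sum_distrib_left)
  also have "\<dots> = Poly_Mapping.lookup (twist_coset p \<sigma>) \<alpha>"
    unfolding sum_part_cosets[OF fin] twist_coset_def lookup_twist coset_rep_def character_def by simp
  finally show "Poly_Mapping.lookup (twist_coset p \<sigma>) \<alpha> =
      Poly_Mapping.lookup (\<Sum>\<xi>\<in>cosets_G' M. const (dft \<xi> \<sigma>) * part \<xi> p) \<alpha>" by simp
qed

lemma dft_orthogonal_G:
  assumes "det M \<noteq> 0" "\<xi> \<in> cosets_G' M" "\<eta> \<in> cosets_G' M"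
  shows "(\<Sum>\<sigma>\<in>cosets_G M. cnj (dft \<xi> \<sigma>) * dft \<eta> \<sigma>) = (if \<xi> = \<eta> then of_int \<bar>det M\<bar> else 0)"
  unfolding character_orthogonality_G[OF assms(1)]
  using cosets_G'_mem[OF assms(2) coset_rep_mem[OF assms(2)]]
    cosets_G'_mem[OF assms(3) coset_rep_mem[OF assms(3)]] by simp

lemma dft_orthogonal_G':
  assumes "det M \<noteq> 0" "\<sigma> \<in> cosets_G M" "\<tau> \<in> cosets_G M"
  shows "(\<Sum>\<xi>\<in>cosets_G' M. cnj (dft \<xi> \<sigma>) * dft \<xi> \<tau>) = (if \<sigma> = \<tau> then of_int \<bar>det M\<bar> else 0)"
  unfolding character_orthogonality_G'[OF assms(1) coset_rep_dual_lattice(1)[OF assms(1,2)]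
      coset_rep_dual_lattice(1)[OF assms(1,3)]]
  using coset_rep_dual_lattice(2)[OF assms(1,2)] coset_rep_dual_lattice(2)[OF assms(1,3)] by simp

text \<open>Fourier inversion, for an abstract pair of biorthogonal tables \<open>W\<close> and
  \<open>V\<close>, because it is used with the character table and with its conjugate.\<close>

lemma const_inversion:
  fixes Y :: "'x \<Rightarrow> 'a::comm_monoid_add \<Rightarrow>\<^sub>0 complex"
  assumes "finite X" "\<zeta> \<in> X"
    and orth: "\<And>\<xi>. \<xi> \<in> X \<Longrightarrow> (\<Sum>\<sigma>\<in>S. W \<sigma> * V \<xi> \<sigma>) = (if \<xi> = \<zeta> then c else 0)"
  shows "(\<Sum>\<sigma>\<in>S. const (W \<sigma>) * (\<Sum>\<xi>\<in>X. const (V \<xi> \<sigma>) * Y \<xi>)) = const c * Y \<zeta>"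
proof -
  have "(\<Sum>\<sigma>\<in>S. const (W \<sigma>) * (\<Sum>\<xi>\<in>X. const (V \<xi> \<sigma>) * Y \<xi>))
      = (\<Sum>\<sigma>\<in>S. \<Sum>\<xi>\<in>X. const (W \<sigma> * V \<xi> \<sigma>) * Y \<xi>)"
    by (simp add: sum_distrib_left mult.assoc[symmetric] const_mult)
  also have "\<dots> = (\<Sum>\<xi>\<in>X. const (\<Sum>\<sigma>\<in>S. W \<sigma> * V \<xi> \<sigma>) * Y \<xi>)"
    unfolding const_sum sum_distrib_right by (rule sum.swap)
  also have "\<dots> = (\<Sum>\<xi>\<in>X. if \<xi> = \<zeta> then const c * Y \<xi> else 0)"
    by (rule sum.cong[OF refl]) (simp add: orth)
  also have "\<dots> = const c * Y \<zeta>" using assms(1,2) by simp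
  finally show ?thesis .
qed

text \<open>The Fourier transform of a matrix indexed by exponent cosets, conjugate in the first
  index. It takes matrices of products of components to matrices of products of twists.\<close>

definition sesqui :: "int^'d::finite^'d \<Rightarrow> ((int^'d) set \<Rightarrow> (int^'d) set \<Rightarrow> 'd laurent) \<Rightarrow>
    (real^'d) set \<Rightarrow> (real^'d) set \<Rightarrow> 'd laurent" where
  "sesqui M X \<sigma> \<tau> = (\<Sum>\<xi>\<in>cosets_G' M. const (cnj (dft \<xi> \<sigma>)) *
     (\<Sum>\<eta>\<in>cosets_G' M. const (dft \<eta> \<tau>) * X \<xi> \<eta>))"

lemma sesqui_parts:
  assumes "det M \<noteq> 0" "\<sigma> \<in> cosets_G M" "\<tau> \<in> cosets_G M"
  shows "star (twist_coset a \<sigma>) * twist_coset b \<tau> =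
    sesqui M (\<lambda>\<xi> \<eta>. star (part \<xi> a) * part \<eta> b) \<sigma> \<tau>"
  unfolding twist_coset_eq_sum_parts[OF assms(1,2)] twist_coset_eq_sum_parts[OF assms(1,3)]
    sesqui_def star_sum star_mult star_const sum_distrib_right
proof (rule sum.cong[OF refl])
  show "const (cnj (dft \<xi> \<sigma>)) * star (part \<xi> a) * (\<Sum>\<eta>\<in>cosets_G' M. const (dft \<eta> \<tau>) * part \<eta> b)
      = const (cnj (dft \<xi> \<sigma>)) *
        (\<Sum>\<eta>\<in>cosets_G' M. const (dft \<eta> \<tau>) * (star (part \<xi> a) * part \<eta> b))" for \<xi>
    by (simp add: sum_distrib_left mult_ac)
qed

lemma sesqui_diff: "sesqui M (\<lambda>\<xi> \<eta>. X \<xi> \<eta> - Y \<xi> \<eta>) \<sigma> \<tau> = sesqui M X \<sigma> \<tau> - sesqui M Y \<sigma> \<tau>"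
  by (simp add: sesqui_def right_diff_distrib sum_subtractf)

lemma sesqui_sum: "sesqui M (\<lambda>\<xi> \<eta>. \<Sum>j\<in>S. X j \<xi> \<eta>) \<sigma> \<tau> = (\<Sum>j\<in>S. sesqui M (X j) \<sigma> \<tau>)"
proof (induction S rule: infinite_finite_induct)
  case (insert j S)
  have "sesqui M (\<lambda>\<xi> \<eta>. X j \<xi> \<eta> + (\<Sum>j\<in>S. X j \<xi> \<eta>)) \<sigma> \<tau> = sesqui M (X j) \<sigma> \<tau> + sesqui M (\<lambda>\<xi> \<eta>. \<Sum>j\<in>S. X j \<xi> \<eta>) \<sigma> \<tau>"
    by (simp add: sesqui_def distrib_left sum.distrib)
  with insert show ?case by simp
qed (simp_all add: sesqui_def)

lemma sesqui_identity:
  assumes "det M \<noteq> 0" "\<sigma> \<in> cosets_G M" "\<tau> \<in> cosets_G M"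
  shows "sesqui M (\<lambda>\<xi> \<eta>. if \<xi> = \<eta> then const (1 / of_int \<bar>det M\<bar>) else 0) \<sigma> \<tau> = (if \<sigma> = \<tau> then 1 else 0)"
proof -
  have fin: "finite (cosets_G' M)" using card_cosets_G'(1)[OF assms(1)] .
  let ?c = "1 / of_int \<bar>det M\<bar> :: complex"
  have inner: "(\<Sum>\<eta>\<in>cosets_G' M. const (dft \<eta> \<tau>) * (if \<xi> = \<eta> then const ?c else 0))
      = const (dft \<xi> \<tau>) * const ?c" if "\<xi> \<in> cosets_G' M" for \<xi>
  proof -
    have "(\<Sum>\<eta>\<in>cosets_G' M. const (dft \<eta> \<tau>) * (if \<xi> = \<eta> then const ?c else 0))
        = (\<Sum>\<eta>\<in>cosets_G' M. if \<xi> = \<eta> then const (dft \<eta> \<tau>) * const ?c else 0)"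
      by (rule sum.cong) auto
    then show ?thesis using fin that by simp
  qed
  have "sesqui M (\<lambda>\<xi> \<eta>. if \<xi> = \<eta> then const ?c else 0) \<sigma> \<tau>
      = (\<Sum>\<xi>\<in>cosets_G' M. const (cnj (dft \<xi> \<sigma>) * dft \<xi> \<tau>) * const ?c)"
    unfolding sesqui_def
    by (rule sum.cong[OF refl]) (simp only: inner const_mult mult.assoc)
  also have "\<dots> = const ((\<Sum>\<xi>\<in>cosets_G' M. cnj (dft \<xi> \<sigma>) * dft \<xi> \<tau>) * ?c)"
    unfolding const_mult[symmetric] const_sum sum_distrib_right ..
  also have "\<dots> = (if \<sigma> = \<tau> then 1 else 0)"
    unfolding dft_orthogonal_G'[OF assms] using assms(1) by (simp add: const_1)
  finally show ?thesis .
qed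

lemma const_cancel:
  fixes Y Z :: "'a::comm_monoid_add \<Rightarrow>\<^sub>0 complex"
  assumes "c \<noteq> 0" "const c * Y = const c * Z"
  shows "Y = Z"
proof -
  have "const (1 / c) * (const c * Y) = const (1 / c) * (const c * Z)" using assms(2) by simp
  then show ?thesis using assms(1) by (simp add: mult.assoc[symmetric] const_mult const_1)
qed

text \<open>Invert the transform in the outer variable and then in the inner one.\<close>

lemma sesqui_inj:
  assumes det: "det M \<noteq> 0"
    and eq: "\<And>\<sigma> \<tau>. \<sigma> \<in> cosets_G M \<Longrightarrow> \<tau> \<in> cosets_G M \<Longrightarrow> sesqui M X \<sigma> \<tau> = sesqui M Y \<sigma> \<tau>"
    and \<xi>: "\<xi> \<in> cosets_G' M" and \<eta>: "\<eta> \<in> cosets_G' M"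
  shows "X \<xi> \<eta> = Y \<xi> \<eta>"
proof -
  have fin: "finite (cosets_G' M)" using card_cosets_G'(1)[OF det] .
  let ?m = "of_int \<bar>det M\<bar> :: complex"
  have m: "?m \<noteq> 0" using det by simp
  define r where "r Z \<tau> \<zeta> = (\<Sum>\<eta>\<in>cosets_G' M. const (dft \<eta> \<tau>) * Z \<zeta> \<eta>)"
    for Z :: "(int^'a) set \<Rightarrow> (int^'a) set \<Rightarrow> 'a laurent" and \<tau> \<zeta>
  have outer: "(\<Sum>\<sigma>\<in>cosets_G M. const (dft \<xi> \<sigma>) * sesqui M Z \<sigma> \<tau>) = const ?m * r Z \<tau> \<xi>" for Z \<tau>
    unfolding sesqui_def r_def[symmetric]
  proof (rule const_inversion[OF fin \<xi>])
    show "(\<Sum>\<sigma>\<in>cosets_G M. dft \<xi> \<sigma> * cnj (dft \<zeta> \<sigma>)) = (if \<zeta> = \<xi> then ?m else 0)"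
      if "\<zeta> \<in> cosets_G' M" for \<zeta>
      using dft_orthogonal_G[OF det that \<xi>] by (simp only: mult.commute)
  qed
  have inner: "(\<Sum>\<tau>\<in>cosets_G M. const (cnj (dft \<eta> \<tau>)) * r Z \<tau> \<xi>) = const ?m * Z \<xi> \<eta>" for Z
    unfolding r_def
  proof (rule const_inversion[OF fin \<eta>])
    show "(\<Sum>\<tau>\<in>cosets_G M. cnj (dft \<eta> \<tau>) * dft \<zeta> \<tau>) = (if \<zeta> = \<eta> then ?m else 0)"
      if "\<zeta> \<in> cosets_G' M" for \<zeta>
      using dft_orthogonal_G[OF det \<eta> that] by auto
  qed
  have r: "r X \<tau> \<xi> = r Y \<tau> \<xi>" if "\<tau> \<in> cosets_G M" for \<tau>
  proof (rule const_cancel[OF m])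
    show "const ?m * r X \<tau> \<xi> = const ?m * r Y \<tau> \<xi>"
      unfolding outer[symmetric] using eq that by (intro sum.cong refl) simp
  qed
  show ?thesis
  proof (rule const_cancel[OF m])
    show "const ?m * X \<xi> \<eta> = const ?m * Y \<xi> \<eta>"
      unfolding inner[symmetric] using r by (intro sum.cong refl) simp
  qed
qed

text \<open>The character table is a multiple of a unitary matrix, and the trace is invariant
  under unitary conjugation.\<close>

lemma sesqui_trace:
  assumes det: "det M \<noteq> 0"
  shows "(\<Sum>\<sigma>\<in>cosets_G M. sesqui M X \<sigma> \<sigma>) = const (of_int \<bar>det M\<bar>) * (\<Sum>\<xi>\<in>cosets_G' M. X \<xi> \<xi>)"
proof -
  have fin: "finite (cosets_G' M)" using card_cosets_G'(1)[OF det] .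
  have "(\<Sum>\<sigma>\<in>cosets_G M. const (cnj (dft \<xi> \<sigma>)) * (\<Sum>\<eta>\<in>cosets_G' M. const (dft \<eta> \<sigma>) * X \<xi> \<eta>))
      = const (of_int \<bar>det M\<bar>) * X \<xi> \<xi>" if \<xi>: "\<xi> \<in> cosets_G' M" for \<xi>
  proof (rule const_inversion[OF fin \<xi>])
    show "(\<Sum>\<sigma>\<in>cosets_G M. cnj (dft \<xi> \<sigma>) * dft \<zeta> \<sigma>) = (if \<zeta> = \<xi> then of_int \<bar>det M\<bar> else 0)"
      if "\<zeta> \<in> cosets_G' M" for \<zeta>
      using dft_orthogonal_G[OF det \<xi> that] by auto
  qed
  then have "(\<Sum>\<xi>\<in>cosets_G' M. \<Sum>\<sigma>\<in>cosets_G M. const (cnj (dft \<xi> \<sigma>)) *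
        (\<Sum>\<eta>\<in>cosets_G' M. const (dft \<eta> \<sigma>) * X \<xi> \<eta>))
      = (\<Sum>\<xi>\<in>cosets_G' M. const (of_int \<bar>det M\<bar>) * X \<xi> \<xi>)"
    by (intro sum.cong refl)
  then show ?thesis
    unfolding sesqui_def sum_distrib_left[symmetric] by (subst sum.swap)
qed

text \<open>Both sides of the two identities correspond to each other under the injective
  transform \<open>sesqui\<close>.\<close>

theorem polyphase_sos_iff_twist:
  fixes M :: "int^'d::finite^'d" and p :: "'d laurent"
  assumes det: "det M \<noteq> 0"
  shows "polyphase_sos M p \<longleftrightarrow> (\<exists>(N::nat) q. \<forall>\<sigma>\<in>cosets_G M. \<forall>\<tau>\<in>cosets_G M.
        (if \<sigma> = \<tau> then 1 else 0) - star (twist_coset p \<sigma>) * twist_coset p \<tau> =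
          (\<Sum>j<N. star (twist_coset (q j) \<sigma>) * twist_coset (q j) \<tau>))"
proof -
  define X where "X \<xi> \<eta> = (if \<xi> = \<eta> then const (1 / of_int \<bar>det M\<bar>) else 0) - star (part \<xi> p) * part \<eta> p"
    for \<xi> \<eta> :: "(int^'d) set"
  define Y where "Y N q \<xi> \<eta> = (\<Sum>j<N. star (part \<xi> (q j)) * part \<eta> (q j))"
    for N :: nat and q :: "nat \<Rightarrow> 'd laurent" and \<xi> \<eta> :: "(int^'d) set"
  have X: "sesqui M X \<sigma> \<tau> = (if \<sigma> = \<tau> then 1 else 0) - star (twist_coset p \<sigma>) * twist_coset p \<tau>"
    if "\<sigma> \<in> cosets_G M" "\<tau> \<in> cosets_G M" for \<sigma> \<tau>
    unfolding X_def sesqui_diff sesqui_identity[OF det that] sesqui_parts[OF det that] ..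
  have Y: "sesqui M (Y N q) \<sigma> \<tau> = (\<Sum>j<N. star (twist_coset (q j) \<sigma>) * twist_coset (q j) \<tau>)"
    if "\<sigma> \<in> cosets_G M" "\<tau> \<in> cosets_G M" for N q \<sigma> \<tau>
    unfolding Y_def sesqui_sum sesqui_parts[OF det that] ..
  have "(\<forall>\<xi>\<in>cosets_G' M. \<forall>\<eta>\<in>cosets_G' M. X \<xi> \<eta> = Y N q \<xi> \<eta>) \<longleftrightarrow>
      (\<forall>\<sigma>\<in>cosets_G M. \<forall>\<tau>\<in>cosets_G M. sesqui M X \<sigma> \<tau> = sesqui M (Y N q) \<sigma> \<tau>)" for N q
  proof
    assume "\<forall>\<xi>\<in>cosets_G' M. \<forall>\<eta>\<in>cosets_G' M. X \<xi> \<eta> = Y N q \<xi> \<eta>"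
    then show "\<forall>\<sigma>\<in>cosets_G M. \<forall>\<tau>\<in>cosets_G M. sesqui M X \<sigma> \<tau> = sesqui M (Y N q) \<sigma> \<tau>"
      by (simp add: sesqui_def)
  next
    assume "\<forall>\<sigma>\<in>cosets_G M. \<forall>\<tau>\<in>cosets_G M. sesqui M X \<sigma> \<tau> = sesqui M (Y N q) \<sigma> \<tau>"
    then show "\<forall>\<xi>\<in>cosets_G' M. \<forall>\<eta>\<in>cosets_G' M. X \<xi> \<eta> = Y N q \<xi> \<eta>"
      using sesqui_inj[OF det] by blast
  qed
  then show ?thesis
    unfolding polyphase_sos_def X_def[symmetric] Y_def[symmetric] using X Y by simp
qed

section \<open>Sums of squares modulo the ideal J\<close>

lemma part_neg_tensor_star:
  "part (uminus ` \<xi> \<times> \<eta>) (tensor (star p) q) = tensor (star (part \<xi> p)) (part \<eta> q)"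
  unfolding part_tensor part_star ..

lemma ball_uminus_cosets_G':
  "(\<forall>\<zeta>\<in>cosets_G' M. P \<zeta>) \<longleftrightarrow> (\<forall>\<xi>\<in>cosets_G' M. P (uminus ` \<xi>))"
proof (intro iffI ballI)
  fix \<zeta> assume "\<forall>\<xi>\<in>cosets_G' M. P (uminus ` \<xi>)" "\<zeta> \<in> cosets_G' M"
  then have "P (uminus ` uminus ` \<zeta>)" using uminus_cosets_G' by blast
  then show "P \<zeta>" by (simp add: image_image)
qed (use uminus_cosets_G' in blast)

text \<open>Take the component of degree \<open>(-\<xi>, \<eta>)\<close> and apply
  \<open>\<mu>\<close>. The lifts contribute \<open>1/m\<close> if \<open>\<xi> = \<eta>\<close>
  and nothing otherwise, so that their choice does not matter.\<close>

theorem J_congruence_iff_polyphase_sos: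
  fixes M :: "int^'d::finite^'d" and p :: "'d laurent"
  assumes det: "det M \<noteq> 0"
    and h: "\<forall>\<xi>\<in>cosets_G' M. h \<xi> \<in> bigraded (uminus ` \<xi>) \<xi> \<and> hermitian (h \<xi>) \<and>
              mu (h \<xi>) = Poly_Mapping.single 0 (1 / of_int \<bar>det M\<bar>)"
  shows "(\<exists>(N::nat) q. (\<Sum>\<xi>\<in>cosets_G' M. h \<xi>) - tensor (star p) p -
              (\<Sum>j<N. tensor (star (q j)) (q j)) \<in> J_ideal M) \<longleftrightarrow> polyphase_sos M p"
proof -
  have fin: "finite (cosets_G' M)" using card_cosets_G'(1)[OF det] .
  let ?c = "const (1 / of_int \<bar>det M\<bar>) :: 'd laurent"
  have mu_h: "mu (part (uminus ` \<xi> \<times> \<eta>) (\<Sum>\<zeta>\<in>cosets_G' M. h \<zeta>)) = (if \<xi> = \<eta> then ?c else 0)"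
    if \<xi>: "\<xi> \<in> cosets_G' M" and \<eta>: "\<eta> \<in> cosets_G' M" for \<xi> \<eta>
  proof -
    have "part (uminus ` \<xi> \<times> \<eta>) (h \<zeta>) = (if \<zeta> = \<eta> then if \<xi> = \<eta> then h \<eta> else 0 else 0)"
      if \<zeta>: "\<zeta> \<in> cosets_G' M" for \<zeta>
    proof -
      have inj: "uminus ` \<xi> = uminus ` \<zeta> \<longleftrightarrow> \<xi> = \<zeta>"
        by (rule inj_image_eq_iff) (simp add: inj_on_def)
      have "h \<zeta> \<in> bigraded (uminus ` \<zeta>) \<zeta>" using h \<zeta> by blast
      from part_bigraded[OF uminus_cosets_G'[OF \<xi>] \<eta> uminus_cosets_G'[OF \<zeta>] \<zeta> this]
      have "part (uminus ` \<xi> \<times> \<eta>) (h \<zeta>) = (if \<xi> = \<zeta> \<and> \<eta> = \<zeta> then h \<zeta> else 0)"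
        unfolding inj .
      then show ?thesis by (cases "\<zeta> = \<eta>") simp_all
    qed
    then have "part (uminus ` \<xi> \<times> \<eta>) (\<Sum>\<zeta>\<in>cosets_G' M. h \<zeta>)
        = (\<Sum>\<zeta>\<in>cosets_G' M. if \<zeta> = \<eta> then if \<xi> = \<eta> then h \<eta> else 0 else 0)"
      unfolding part_sum by (intro sum.cong refl)
    also have "\<dots> = (if \<xi> = \<eta> then h \<eta> else 0)" using fin \<eta> by simp
    finally show ?thesis using h \<eta> by (simp add: mu_zero)
  qed
  have "(\<Sum>\<xi>\<in>cosets_G' M. h \<xi>) - tensor (star p) p - (\<Sum>j<N. tensor (star (q j)) (q j)) \<in> J_ideal M \<longleftrightarrow>
      (\<forall>\<xi>\<in>cosets_G' M. \<forall>\<eta>\<in>cosets_G' M. (if \<xi> = \<eta> then ?c else 0) - star (part \<xi> p) * part \<eta> p =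
        (\<Sum>j<N. star (part \<xi> (q j)) * part \<eta> (q j)))" for N :: nat and q
  proof -
    let ?g = "(\<Sum>\<xi>\<in>cosets_G' M. h \<xi>) - tensor (star p) p - (\<Sum>j<N. tensor (star (q j)) (q j))"
    have "?g \<in> J_ideal M \<longleftrightarrow> (\<forall>\<xi>\<in>cosets_G' M. \<forall>\<eta>\<in>cosets_G' M. mu (part (uminus ` \<xi> \<times> \<eta>) ?g) = 0)"
      unfolding J_ideal_iff[OF fin] by (rule ball_uminus_cosets_G')
    also have "\<dots> \<longleftrightarrow> (\<forall>\<xi>\<in>cosets_G' M. \<forall>\<eta>\<in>cosets_G' M.
        (if \<xi> = \<eta> then ?c else 0) - star (part \<xi> p) * part \<eta> p =
        (\<Sum>j<N. star (part \<xi> (q j)) * part \<eta> (q j)))"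
    proof (intro ball_cong refl)
      fix \<xi> \<eta> assume "\<xi> \<in> cosets_G' M" "\<eta> \<in> cosets_G' M"
      then have "mu (part (uminus ` \<xi> \<times> \<eta>) ?g) = (if \<xi> = \<eta> then ?c else 0) - star (part \<xi> p) * part \<eta> p -
          (\<Sum>j<N. star (part \<xi> (q j)) * part \<eta> (q j))"
        by (simp only: part_diff part_sum[where I = "{..<N}"] part_neg_tensor_star mu_diff mu_sum mu_tensor mu_h)
      then show "mu (part (uminus ` \<xi> \<times> \<eta>) ?g) = 0 \<longleftrightarrow>
          (if \<xi> = \<eta> then ?c else 0) - star (part \<xi> p) * part \<eta> p =
          (\<Sum>j<N. star (part \<xi> (q j)) * part \<eta> (q j))"
        by (simp only: right_minus_eq)
    qed
    finally show ?thesis .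
  qed
  then show ?thesis unfolding polyphase_sos_def by simp
qed

text \<open>The elements \<open>z\<^sup>-\<^sup>\<alpha> \<otimes> z\<^sup>\<alpha> / m\<close>
  with \<open>\<alpha>\<close> in the coset are admissible.\<close>

lemma hermitian_lift_exists:
  fixes M :: "int^'d::finite^'d"
  obtains h where "\<forall>\<xi>\<in>cosets_G' M. h \<xi> \<in> bigraded (uminus ` \<xi>) \<xi> \<and> hermitian (h \<xi>) \<and>
              mu (h \<xi>) = Poly_Mapping.single 0 (1 / of_int \<bar>det M\<bar>)"
proof
  let ?a = coset_rep and ?c = "1 / of_int \<bar>det M\<bar> :: complex"
  define h where "h \<xi> = tensor (Poly_Mapping.single (- ?a \<xi>) 1) (Poly_Mapping.single (?a \<xi>) ?c)"
    for \<xi> :: "(int^'d) set"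
  have h: "h \<xi> = Poly_Mapping.single (- ?a \<xi>, ?a \<xi>) ?c" for \<xi>
    unfolding h_def by (rule poly_mapping_eqI) (auto simp: lookup_tensor lookup_single when_def split: if_splits)
  show "\<forall>\<xi>\<in>cosets_G' M. h \<xi> \<in> bigraded (uminus ` \<xi>) \<xi> \<and> hermitian (h \<xi>) \<and> mu (h \<xi>) = const ?c"
  proof (intro ballI conjI)
    fix \<xi> assume "\<xi> \<in> cosets_G' M"
    then have "?a \<xi> \<in> \<xi>" by (rule coset_rep_mem)
    then show "h \<xi> \<in> bigraded (uminus ` \<xi>) \<xi>"
      unfolding bigraded_def monomial_span_eq h by auto
    have "Poly_Mapping.lookup (star2 (h \<xi>)) (\<alpha>, \<beta>) = Poly_Mapping.lookup (h \<xi>) (\<alpha>, \<beta>)" for \<alpha> \<beta>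
      unfolding lookup_star2 h lookup_single when_def by auto
    then show "hermitian (h \<xi>)"
      unfolding hermitian_def by (intro poly_mapping_eqI) auto
    show "mu (h \<xi>) = const ?c"
      unfolding h_def mu_tensor by (simp add: mult_single)
  qed
qed

section \<open>From the matrix identity to a scalar sum of squares\<close>

text \<open>With \<open>g = v\<^sup>*v\<close>, evaluating the matrix identity at \<open>v\<close>
  shows that \<open>g - g\<^sup>2\<close> is a sum of squares, and \<open>1 - g = (1 - g)\<^sup>2
  + (g - g\<^sup>2)\<close> where \<open>1 - g\<close> is hermitian.\<close>

theorem twist_sos_imp_sos:
  fixes M :: "int^'d::finite^'d" and p :: "'d laurent" and q :: "nat \<Rightarrow> 'd laurent"
  assumes fin: "finite (cosets_G M)"
    and q: "\<forall>\<sigma>\<in>cosets_G M. \<forall>\<tau>\<in>cosets_G M.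
        (if \<sigma> = \<tau> then 1 else 0) - star (twist_coset p \<sigma>) * twist_coset p \<tau> =
          (\<Sum>j<N. star (twist_coset (q j) \<sigma>) * twist_coset (q j) \<tau>)"
  shows "\<exists>(r::nat) h. 1 - (\<Sum>\<sigma>\<in>cosets_G M. star (twist_coset p \<sigma>) * twist_coset p \<sigma>) =
          (\<Sum>j<r. star (h j) * h j)"
proof -
  let ?G = "cosets_G M" and ?T = "twist_coset p"
  define g where "g = (\<Sum>\<sigma>\<in>?G. star (?T \<sigma>) * ?T \<sigma>)"
  define w where "w j = (\<Sum>\<tau>\<in>?G. twist_coset (q j) \<tau> * star (?T \<tau>))" for j
  have star_g: "star g = g"
    by (simp add: g_def star_sum star_mult star_star mult.commute)
  have "(\<Sum>j<N. star (w j) * w j)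
      = (\<Sum>j<N. \<Sum>\<sigma>\<in>?G. \<Sum>\<tau>\<in>?G. ?T \<sigma> * (star (twist_coset (q j) \<sigma>) * twist_coset (q j) \<tau>) * star (?T \<tau>))"
    unfolding w_def star_sum star_mult star_star sum_product
    by (intro sum.cong refl) (simp add: mult_ac)
  also have "\<dots> = (\<Sum>\<sigma>\<in>?G. \<Sum>j<N. \<Sum>\<tau>\<in>?G. ?T \<sigma> * (star (twist_coset (q j) \<sigma>) * twist_coset (q j) \<tau>) * star (?T \<tau>))"
    by (rule sum.swap)
  also have "\<dots> = (\<Sum>\<sigma>\<in>?G. \<Sum>\<tau>\<in>?G. \<Sum>j<N. ?T \<sigma> * (star (twist_coset (q j) \<sigma>) * twist_coset (q j) \<tau>) * star (?T \<tau>))"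
    by (intro sum.cong refl sum.swap)
  also have "\<dots> = (\<Sum>\<sigma>\<in>?G. \<Sum>\<tau>\<in>?G. ?T \<sigma> * ((if \<sigma> = \<tau> then 1 else 0) - star (?T \<sigma>) * ?T \<tau>) * star (?T \<tau>))"
    using q by (intro sum.cong refl) (simp add: sum_distrib_left sum_distrib_right)
  also have "\<dots> = (\<Sum>\<sigma>\<in>?G. \<Sum>\<tau>\<in>?G. (if \<sigma> = \<tau> then star (?T \<tau>) * ?T \<tau> else 0)
      - (star (?T \<sigma>) * ?T \<sigma>) * (star (?T \<tau>) * ?T \<tau>))"
    by (intro sum.cong refl) (simp add: algebra_simps)
  also have "\<dots> = g - g * g"
    using fin by (simp add: sum_subtractf g_def sum_product)
  finally have w: "(\<Sum>j<N. star (w j) * w j) = g - g * g" .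
  define h where "h j = (case j of 0 \<Rightarrow> 1 - g | Suc k \<Rightarrow> w k)" for j
  have "(\<Sum>j<Suc N. star (h j) * h j) = star (1 - g) * (1 - g) + (\<Sum>j<N. star (w j) * w j)"
    unfolding sum.lessThan_Suc_shift h_def by simp
  also have "\<dots> = 1 - g"
    unfolding w star_diff star_one star_g by (simp add: algebra_simps)
  finally show ?thesis unfolding g_def by metis
qed

section \<open>From a scalar sum of squares to the matrix identity\<close>

text \<open>The product has degree \<open>\<eta> - \<xi>\<close>.\<close>

lemma part_star_mult:
  fixes M :: "int^'d::finite^'d"
  assumes "\<xi> \<in> cosets_G' M" "\<eta> \<in> cosets_G' M"
  shows "part (range ((*v) M)) (star (part \<xi> a) * part \<eta> b) = (if \<xi> = \<eta> then star (part \<xi> a) * part \<eta> b else 0)"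
proof -
  let ?R = "range ((*v) M)" and ?f = "star (part \<xi> a) * part \<eta> b"
  have keys: "\<exists>\<alpha>\<in>\<xi>. \<exists>\<beta>\<in>\<eta>. k = \<beta> - \<alpha>" if "k \<in> Poly_Mapping.keys ?f" for k
  proof -
    obtain x y where k: "k = x + y" "x \<in> Poly_Mapping.keys (star (part \<xi> a))" "y \<in> Poly_Mapping.keys (part \<eta> b)"
      using \<open>k \<in> _\<close> keys_mult[of "star (part \<xi> a)" "part \<eta> b"] by blast
    have "- x \<in> \<xi>" using k(2) by (auto simp: in_keys_iff lookup_star lookup_part split: if_splits)
    moreover have "y \<in> \<eta>" using k(3) unfolding keys_part by blast
    moreover have "k = y - (- x)" using k(1) by (simp add: add.commute)
    ultimately show ?thesis by blast
  qed
  have mem: "\<beta> - \<alpha> \<in> ?R \<longleftrightarrow> \<xi> = \<eta>" if "\<alpha> \<in> \<xi>" "\<beta> \<in> \<eta>" for \<alpha> \<beta>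
    using coset_eq_iff[OF diff_closed_range_matrix[of M], of \<beta> \<alpha>]
      cosets_G'_mem[OF assms(1) that(1)] cosets_G'_mem[OF assms(2) that(2)] by auto
  have keys_mem: "k \<in> ?R \<longleftrightarrow> \<xi> = \<eta>" if k: "k \<in> Poly_Mapping.keys ?f" for k
  proof -
    obtain \<alpha> \<beta> where "\<alpha> \<in> \<xi>" "\<beta> \<in> \<eta>" "k = \<beta> - \<alpha>" using keys[OF k] by blast
    then show ?thesis using mem by simp
  qed
  show ?thesis
  proof (cases "\<xi> = \<eta>")
    case True
    have "Poly_Mapping.keys ?f \<subseteq> ?R" using True by (intro subsetI) (simp only: keys_mem)
    then show ?thesis unfolding if_P[OF True] by (rule part_eq_self)
  next
    case False
    have "Poly_Mapping.keys ?f \<inter> ?R = {}" using False by (intro equals0I, elim IntE) (simp only: keys_mem)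
    then show ?thesis unfolding if_not_P[OF False] by (rule part_eq_zero)
  qed
qed

text \<open>The mixed products of two different components have nonzero degree.\<close>

lemma part_star_mult_self:
  fixes M :: "int^'d::finite^'d"
  assumes "finite (cosets_G' M)"
  shows "part (range ((*v) M)) (star h * h) = (\<Sum>\<xi>\<in>cosets_G' M. star (part \<xi> h) * part \<xi> h)"
proof -
  have "part (range ((*v) M)) (star h * h) = part (range ((*v) M)) ((\<Sum>\<xi>\<in>cosets_G' M. star (part \<xi> h)) * (\<Sum>\<eta>\<in>cosets_G' M. part \<eta> h))"
    unfolding star_sum[symmetric] sum_part_cosets[OF assms] ..
  also have "\<dots> = (\<Sum>\<xi>\<in>cosets_G' M. \<Sum>\<eta>\<in>cosets_G' M. if \<xi> = \<eta> then star (part \<xi> h) * part \<eta> h else 0)"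
    unfolding sum_product part_sum by (intro sum.cong refl part_star_mult)
  finally show ?thesis using assms by simp
qed

text \<open>The monomial moves the homogeneous factor into degree zero, and factors of degree zero
  commute with taking components.\<close>

lemma part_shifted_star_mult:
  fixes M :: "int^'d::finite^'d"
  assumes "\<rho> \<in> cosets_G' M" "\<xi> \<in> cosets_G' M"
  shows "part \<xi> (Poly_Mapping.single (coset_rep \<rho>) 1 * star (part \<rho> a) * b) =
      Poly_Mapping.single (coset_rep \<rho>) 1 * star (part \<rho> a) * part \<xi> b"
    and "part \<xi> (Poly_Mapping.single (- coset_rep \<rho>) 1 * part \<rho> a * b) =
      Poly_Mapping.single (- coset_rep \<rho>) 1 * part \<rho> a * part \<xi> b"
proof -
  let ?R = "range ((*v) M)"
  have R: "- x \<in> ?R \<longleftrightarrow> x \<in> ?R" for x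
  proof -
    have "- y \<in> ?R" if "y \<in> ?R" for y
      using diff_closed_range_matrix[of M] that unfolding diff_closed_def by (metis diff_0)
    from this[of x] this[of "- x"] show ?thesis by auto
  qed
  have same: "\<beta> - \<alpha> \<in> ?R" if "\<alpha> \<in> \<rho>" "\<beta> \<in> \<rho>" for \<alpha> \<beta>
    using coset_eq_iff[OF diff_closed_range_matrix[of M], of \<beta> \<alpha>]
      cosets_G'_mem[OF assms(1) that(1)] cosets_G'_mem[OF assms(1) that(2)] by auto
  have rep: "coset_rep \<rho> \<in> \<rho>" using assms(1) by (rule coset_rep_mem)
  have shift: "(\<lambda>l. k + l) -` \<xi> = \<xi>" if "k \<in> ?R" for k
  proof -
    obtain \<beta> where \<beta>: "\<xi> = \<beta> +o ?R" using assms(2) unfolding cosets_G'_eq by blast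
    have "k + l - \<beta> \<in> ?R \<longleftrightarrow> l - \<beta> \<in> ?R" for l
    proof -
      have "l - \<beta> - (- k) \<in> ?R" if "l - \<beta> \<in> ?R"
        using diff_closed_range_matrix[of M] that R[of k] \<open>k \<in> ?R\<close> unfolding diff_closed_def by blast
      moreover have "(k + l - \<beta>) - k \<in> ?R" if "k + l - \<beta> \<in> ?R"
        using diff_closed_range_matrix[of M] that \<open>k \<in> ?R\<close> unfolding diff_closed_def by blast
      ultimately show ?thesis by (auto simp: algebra_simps)
    qed
    then show ?thesis unfolding \<beta> by (auto simp: mem_coset_iff)
  qed
  have "k \<in> ?R" if k: "k \<in> Poly_Mapping.keys (Poly_Mapping.single (coset_rep \<rho>) 1 * star (part \<rho> a))" for k
  proof -
    obtain y where y: "k = coset_rep \<rho> + y" "y \<in> Poly_Mapping.keys (star (part \<rho> a))"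
      using k keys_mult[of "Poly_Mapping.single (coset_rep \<rho>) 1" "star (part \<rho> a)"] by auto
    have "- y \<in> \<rho>" using y(2) by (auto simp: in_keys_iff lookup_star lookup_part split: if_splits)
    from same[OF this rep] show ?thesis using y(1) by simp
  qed
  then show "part \<xi> (Poly_Mapping.single (coset_rep \<rho>) 1 * star (part \<rho> a) * b) =
      Poly_Mapping.single (coset_rep \<rho>) 1 * star (part \<rho> a) * part \<xi> b"
    by (intro part_mult_shift shift)
  have "k \<in> ?R" if k: "k \<in> Poly_Mapping.keys (Poly_Mapping.single (- coset_rep \<rho>) 1 * part \<rho> a)" for k
  proof -
    obtain y where y: "k = - coset_rep \<rho> + y" "y \<in> Poly_Mapping.keys (part \<rho> a)"
      using k keys_mult[of "Poly_Mapping.single (- coset_rep \<rho>) 1" "part \<rho> a"] by auto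
    have "y \<in> \<rho>" using y(2) unfolding keys_part by blast
    from same[OF rep this] show ?thesis using y(1) by simp
  qed
  then show "part \<xi> (Poly_Mapping.single (- coset_rep \<rho>) 1 * part \<rho> a * b) =
      Poly_Mapping.single (- coset_rep \<rho>) 1 * part \<rho> a * part \<xi> b"
    by (intro part_mult_shift shift)
qed

lemma star_monomial_mult: "star (Poly_Mapping.single \<alpha> 1) * Poly_Mapping.single \<alpha> 1 = 1"
  by (simp add: star_single mult_single const_1)

text \<open>Brings a sum of squares over any finite index set into the form with consecutive
  indices. The quantifier over \<open>g\<close> stands inside since one enumeration must serve all
  entries of a matrix.\<close>

lemma sum_to_lessThan:
  assumes "finite I"
  shows "\<exists>(N::nat) q'. \<forall>g :: 'q \<Rightarrow> 'b::comm_monoid_add. (\<Sum>i\<in>I. g (q i)) = (\<Sum>j<N. g (q' j))"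
proof -
  obtain e where e: "bij_betw e {0..<card I} I" using ex_bij_betw_nat_finite[OF assms] by blast
  have "(\<Sum>i\<in>I. g (q i)) = (\<Sum>j<card I. g (q (e j)))" for g :: "'q \<Rightarrow> 'b"
    by (simp only: sum.reindex_bij_betw[OF e, symmetric] atLeast0LessThan)
  then show ?thesis by (intro exI allI)
qed

text \<open>Let \<open>w\<close> be the column with the entries \<open>\<surd>m (part \<xi>
  p)\<^sup>*\<close>; then \<open>f = 1 - w\<^sup>*w\<close>, and \<open>1 - ww\<^sup>* = (1 -
  ww\<^sup>*)\<^sup>2 + w f w\<^sup>*\<close> is to be written with rows whose entry in column
  \<open>\<xi>\<close> has degree \<open>\<xi>\<close>. The row of index \<open>\<rho>\<close> of
  \<open>1 - ww\<^sup>*\<close> gets there after multiplication by a monomial of degree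
  \<open>\<rho>\<close>; these are the \<open>q1\<close>. Since \<open>f\<close> has degree zero,
  it is also the sum of the squares of the homogeneous components of the \<open>h j\<close>; moved
  to degree zero by monomials and multiplied by \<open>p\<close> they give the
  \<open>q2\<close>.\<close>

theorem sos_imp_polyphase_sos:
  fixes M :: "int^'d::finite^'d" and p :: "'d laurent" and h :: "nat \<Rightarrow> 'd laurent"
  assumes det: "det M \<noteq> 0"
    and sos: "1 - (\<Sum>\<sigma>\<in>cosets_G M. star (twist_coset p \<sigma>) * twist_coset p \<sigma>) = (\<Sum>j<r. star (h j) * h j)"
  shows "polyphase_sos M p"
proof -
  let ?C = "cosets_G' M" and ?R = "range ((*v) M)"
  have fin: "finite ?C" using card_cosets_G'(1)[OF det] .
  define m :: complex where "m = of_int \<bar>det M\<bar>"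
  \<comment> \<open>The rows of \<open>1 - ww\<^sup>*\<close> are scaled by \<open>1 / \<surd>m\<close>, since the matrix to be represented is \<open>(1 - ww\<^sup>*) / m\<close>.\<close>
  define c :: complex where "c = of_real (1 / sqrt \<bar>of_int (det M)\<bar>)"
  have m: "m \<noteq> 0" using det by (simp add: m_def)
  have cc: "cnj c * c = 1 / m"
  proof -
    have "m = of_real \<bar>of_int (det M)\<bar>" by (simp add: m_def flip: of_int_abs)
    then show ?thesis
      unfolding c_def complex_cnj_complex_of_real of_real_mult[symmetric] by simp
  qed
  have cnj_m: "cnj m = m" by (simp add: m_def)
  define P where "P \<xi> = part \<xi> p" for \<xi>
  define H where "H j \<xi> = part \<xi> (h j)" for j :: nat and \<xi>
  define E where "E = (\<Sum>\<rho>\<in>?C. star (P \<rho>) * P \<rho>)"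
  define z where "z \<rho> = (Poly_Mapping.single (coset_rep \<rho>) 1 :: 'd laurent)" for \<rho> :: "(int^'d) set"
  define z' where "z' \<rho> = (Poly_Mapping.single (- coset_rep \<rho>) 1 :: 'd laurent)" for \<rho> :: "(int^'d) set"
  have zz: "star (z \<rho>) * z \<rho> = 1" "star (z' \<rho>) * z' \<rho> = 1" for \<rho>
    unfolding z_def z'_def by (rule star_monomial_mult)+
  have trace: "(\<Sum>\<sigma>\<in>cosets_G M. star (twist_coset p \<sigma>) * twist_coset p \<sigma>) = const m * E"
  proof -
    have "(\<Sum>\<sigma>\<in>cosets_G M. star (twist_coset p \<sigma>) * twist_coset p \<sigma>)
        = (\<Sum>\<sigma>\<in>cosets_G M. sesqui M (\<lambda>\<xi> \<eta>. star (part \<xi> p) * part \<eta> p) \<sigma> \<sigma>)"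
      by (rule sum.cong[OF refl]) (rule sesqui_parts[OF det])
    then show ?thesis unfolding sesqui_trace[OF det] E_def P_def m_def .
  qed
  \<comment> \<open>The left-hand side has degree zero, so only the terms of degree zero of the products survive.\<close>
  have f: "1 - const m * E = (\<Sum>j<r. \<Sum>\<rho>\<in>?C. star (H j \<rho>) * H j \<rho>)"
  proof -
    have "Poly_Mapping.keys (1 :: 'd laurent) \<subseteq> ?R"
      using diff_closed_range_matrix[of M] unfolding diff_closed_def by auto
    then have "part ?R 1 = (1 :: 'd laurent)" by (rule part_eq_self)
    moreover have "part ?R E = E"
      unfolding E_def P_def part_sum by (rule sum.cong[OF refl]) (simp add: part_star_mult)
    ultimately have "part ?R (1 - const m * E) = 1 - const m * E"
      unfolding part_diff part_const_times by simp
    then show ?thesis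
      using sos unfolding trace H_def by (simp add: part_sum part_star_mult_self[OF fin])
  qed
  define q1 where "q1 \<rho> = const c * (z \<rho> - const m * (z \<rho> * star (P \<rho>) * p))" for \<rho>
  define q2 where "q2 i = z' (snd i) * H (fst i) (snd i) * p" for i :: "nat \<times> (int^'d) set"
  \<comment> \<open>The entries of \<open>1 - ww\<^sup>*\<close>.\<close>
  define e where "e \<rho> \<xi> = (if \<rho> = \<xi> then 1 else 0) - const m * (star (P \<rho>) * P \<xi>)"
    for \<rho> \<xi> :: "(int^'d) set"
  have part_q1: "part \<xi> (q1 \<rho>) = const c * (z \<rho> * e \<rho> \<xi>)" if \<rho>: "\<rho> \<in> ?C" and \<xi>: "\<xi> \<in> ?C" for \<rho> \<xi>
  proof -
    have "Poly_Mapping.keys (z \<rho>) \<subseteq> \<rho>" using coset_rep_mem[OF \<rho>] by (simp add: z_def)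
    then have z: "part \<xi> (z \<rho>) = (if \<rho> = \<xi> then z \<rho> else 0)"
      using cosets_G'_disjoint[OF \<rho> \<xi>] part_eq_self[of "z \<rho>" \<xi>] part_eq_zero[of "z \<rho>" \<xi>] by auto
    have zPp: "part \<xi> (z \<rho> * star (P \<rho>) * p) = z \<rho> * star (P \<rho>) * P \<xi>"
      unfolding z_def P_def by (rule part_shifted_star_mult(1)[OF \<rho> \<xi>])
    show ?thesis
      unfolding q1_def e_def part_const_times part_diff z zPp by (simp add: algebra_simps)
  qed
  have part_q2: "part \<xi> (q2 (j, \<rho>)) = z' \<rho> * H j \<rho> * P \<xi>" if "\<rho> \<in> ?C" "\<xi> \<in> ?C" for j \<rho> \<xi>
    unfolding q2_def z'_def H_def P_def fst_conv snd_conv by (rule part_shifted_star_mult(2)[OF that])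
  have gram1: "(\<Sum>\<rho>\<in>?C. star (part \<xi> (q1 \<rho>)) * part \<eta> (q1 \<rho>))
      = const (1 / m) * (if \<xi> = \<eta> then 1 else 0) - 2 * (star (P \<xi>) * P \<eta>) + const m * (star (P \<xi>) * P \<eta>) * E"
    if \<xi>: "\<xi> \<in> ?C" and \<eta>: "\<eta> \<in> ?C" for \<xi> \<eta>
  proof -
    let ?s = "star (P \<xi>) * P \<eta>"
    have summand: "star (part \<xi> (q1 \<rho>)) * part \<eta> (q1 \<rho>) = const (1 / m) * (star (e \<rho> \<xi>) * e \<rho> \<eta>)"
      if \<rho>: "\<rho> \<in> ?C" for \<rho>
    proof -
      have "star (part \<xi> (q1 \<rho>)) * part \<eta> (q1 \<rho>)
          = (const (cnj c) * const c) * (star (z \<rho>) * z \<rho>) * (star (e \<rho> \<xi>) * e \<rho> \<eta>)"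
        unfolding part_q1[OF \<rho> \<xi>] part_q1[OF \<rho> \<eta>] star_mult star_const by (simp only: mult_ac)
      then show ?thesis unfolding zz const_mult cc by simp
    qed
    have expand: "star (e \<rho> \<xi>) * e \<rho> \<eta> = (if \<rho> = \<xi> then if \<xi> = \<eta> then 1 else 0 else 0)
        - (if \<rho> = \<xi> then const m * ?s else 0) - (if \<rho> = \<eta> then const m * ?s else 0)
        + const m * const m * ?s * (star (P \<rho>) * P \<rho>)" for \<rho>
    proof -
      have star_e: "star (e \<rho> \<xi>) = (if \<rho> = \<xi> then 1 else 0) - const m * (P \<rho> * star (P \<xi>))"
        unfolding e_def star_diff star_mult star_star star_const cnj_m
        by (simp add: star_one star_zero)
      show ?thesis
        unfolding star_e unfolding e_def
        by (cases "\<rho> = \<xi>"; cases "\<rho> = \<eta>") (simp_all add: algebra_simps)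
    qed
    have "(\<Sum>\<rho>\<in>?C. star (e \<rho> \<xi>) * e \<rho> \<eta>) = (if \<xi> = \<eta> then 1 else 0) - const m * ?s - const m * ?s
        + const m * const m * ?s * E"
      unfolding expand E_def sum.distrib sum_subtractf sum_distrib_left[symmetric]
      using fin \<xi> \<eta> by simp
    then have "(\<Sum>\<rho>\<in>?C. star (part \<xi> (q1 \<rho>)) * part \<eta> (q1 \<rho>)) = const (1 / m) *
        ((if \<xi> = \<eta> then 1 else 0) - const m * ?s - const m * ?s + const m * const m * ?s * E)"
      by (simp add: summand sum_distrib_left[symmetric])
    also have "\<dots> = const (1 / m) * (if \<xi> = \<eta> then 1 else 0) - 2 * ((const (1 / m) * const m) * ?s)
        + (const (1 / m) * const m) * (const m * ?s * E)"
      by (simp add: algebra_simps)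
    also have "const (1 / m) * const m = (1 :: 'd laurent)"
      using m by (simp add: const_mult const_1)
    finally show ?thesis by simp
  qed
  have gram2: "(\<Sum>i\<in>{..<r} \<times> ?C. star (part \<xi> (q2 i)) * part \<eta> (q2 i)) = (1 - const m * E) * (star (P \<xi>) * P \<eta>)"
    if \<xi>: "\<xi> \<in> ?C" and \<eta>: "\<eta> \<in> ?C" for \<xi> \<eta>
  proof -
    have "star (part \<xi> (q2 (j, \<rho>))) * part \<eta> (q2 (j, \<rho>)) = star (H j \<rho>) * H j \<rho> * (star (P \<xi>) * P \<eta>)"
      if \<rho>: "\<rho> \<in> ?C" for j \<rho>
    proof -
      have "star (part \<xi> (q2 (j, \<rho>))) * part \<eta> (q2 (j, \<rho>))
          = (star (z' \<rho>) * z' \<rho>) * (star (H j \<rho>) * H j \<rho> * (star (P \<xi>) * P \<eta>))"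
        unfolding part_q2[OF \<rho> \<xi>] part_q2[OF \<rho> \<eta>] star_mult by (simp only: mult_ac)
      then show ?thesis unfolding zz by simp
    qed
    then have "(\<Sum>i\<in>{..<r} \<times> ?C. star (part \<xi> (q2 i)) * part \<eta> (q2 i))
        = (\<Sum>j<r. \<Sum>\<rho>\<in>?C. star (H j \<rho>) * H j \<rho> * (star (P \<xi>) * P \<eta>))"
      unfolding sum.cartesian_product' by (intro sum.cong refl)
    then show ?thesis unfolding f sum_distrib_right .
  qed
  define q where "q = case_sum q1 q2"
  have "finite (?C <+> {..<r} \<times> ?C)" using fin by (intro finite_Plus finite_cartesian_product) simp_all
  from sum_to_lessThan[OF this, of q] obtain N :: nat and q'
    where q': "\<forall>g :: 'd laurent \<Rightarrow> 'd laurent. (\<Sum>i\<in>?C <+> {..<r} \<times> ?C. g (q i)) = (\<Sum>j<N. g (q' j))"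
    by (elim exE)
  have "(if \<xi> = \<eta> then const (1 / of_int \<bar>det M\<bar>) else 0) - star (part \<xi> p) * part \<eta> p
      = (\<Sum>j<N. star (part \<xi> (q' j)) * part \<eta> (q' j))" if \<xi>: "\<xi> \<in> ?C" and \<eta>: "\<eta> \<in> ?C" for \<xi> \<eta>
  proof -
    have "(\<Sum>j<N. star (part \<xi> (q' j)) * part \<eta> (q' j))
        = (\<Sum>i\<in>?C <+> {..<r} \<times> ?C. star (part \<xi> (q i)) * part \<eta> (q i))"
      by (rule q'[rule_format, symmetric])
    also have "\<dots> = (\<Sum>\<rho>\<in>?C. star (part \<xi> (q1 \<rho>)) * part \<eta> (q1 \<rho>))
        + (\<Sum>i\<in>{..<r} \<times> ?C. star (part \<xi> (q2 i)) * part \<eta> (q2 i))"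
      using fin by (subst sum.Plus) (simp_all add: q_def)
    also have "\<dots> = const (1 / m) * (if \<xi> = \<eta> then 1 else 0) - star (P \<xi>) * P \<eta>"
      unfolding gram1[OF \<xi> \<eta>] gram2[OF \<xi> \<eta>] by (simp add: algebra_simps)
    finally show ?thesis by (simp add: m_def P_def)
  qed
  then show ?thesis unfolding polyphase_sos_def by blast
qed

section \<open>The equivalence\<close>

theorem theorem3p10:
  fixes M :: "int^'d::finite^'d" and p :: "'d laurent"
  assumes "expansive M"
    and "laurent_eval p 1 = 1"
  shows
    "((\<exists>(r::nat) h.
        1 - (\<Sum>\<sigma>\<in>cosets_G M. star (twist_coset p \<sigma>) * twist_coset p \<sigma>) =
          (\<Sum>j<r. star (h j) * h j))
      \<longleftrightarrow>
      (\<forall>h. (\<forall>\<xi>\<in>cosets_G' M. h \<xi> \<in> bigraded (uminus ` \<xi>) \<xi> \<and> hermitian (h \<xi>) \<and>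
              mu (h \<xi>) = Poly_Mapping.single 0 (1 / of_int \<bar>det M\<bar>)) \<longrightarrow>
           (\<exists>(N::nat) q. (\<Sum>\<xi>\<in>cosets_G' M. h \<xi>) - tensor (star p) p -
              (\<Sum>j<N. tensor (star (q j)) (q j)) \<in> J_ideal M)))
     \<and>
     ((\<forall>h. (\<forall>\<xi>\<in>cosets_G' M. h \<xi> \<in> bigraded (uminus ` \<xi>) \<xi> \<and> hermitian (h \<xi>) \<and>
              mu (h \<xi>) = Poly_Mapping.single 0 (1 / of_int \<bar>det M\<bar>)) \<longrightarrow>
           (\<exists>(N::nat) q. (\<Sum>\<xi>\<in>cosets_G' M. h \<xi>) - tensor (star p) p -
              (\<Sum>j<N. tensor (star (q j)) (q j)) \<in> J_ideal M))
      \<longleftrightarrow>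
      (\<exists>(N::nat) q. \<forall>\<sigma>\<in>cosets_G M. \<forall>\<tau>\<in>cosets_G M.
        (if \<sigma> = \<tau> then 1 else 0) - star (twist_coset p \<sigma>) * twist_coset p \<tau> =
          (\<Sum>j<N. star (twist_coset (q j) \<sigma>) * twist_coset (q j) \<tau>)))"
    (is "(?i \<longleftrightarrow> ?ii) \<and> (?ii \<longleftrightarrow> ?iii)")
proof -
  have det: "det M \<noteq> 0" using assms(1) by (rule expansive_det_nonzero)
  have iii: "polyphase_sos M p \<longleftrightarrow> ?iii" by (rule polyphase_sos_iff_twist[OF det])
  have ii: "?ii \<longleftrightarrow> polyphase_sos M p"
  proof
    assume ?ii
    moreover obtain h where h: "\<forall>\<xi>\<in>cosets_G' M. h \<xi> \<in> bigraded (uminus ` \<xi>) \<xi> \<and> hermitian (h \<xi>) \<and>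
        mu (h \<xi>) = Poly_Mapping.single 0 (1 / of_int \<bar>det M\<bar>)"
      by (rule hermitian_lift_exists)
    ultimately show "polyphase_sos M p"
      using J_congruence_iff_polyphase_sos[OF det h, of p] by blast
  next
    assume sos: "polyphase_sos M p"
    show ?ii
      by (intro allI impI, subst J_congruence_iff_polyphase_sos[OF det]) (use sos in simp_all)
  qed
  have "?i \<Longrightarrow> polyphase_sos M p"
    using sos_imp_polyphase_sos[OF det] by blast
  moreover have "?iii \<Longrightarrow> ?i"
    using twist_sos_imp_sos[OF card_cosets_G(1)[OF det]] by blast
  ultimately show ?thesis using ii iii by blast
qed

end
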